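(* Let $T>0$, $(t_1,x_1),(t_2,x_2)\in\mathbb{R}\times\mathbb{T}$, $v_1,v_2\in\mathbb{Z}$, $v_1\ne v_2$. Then $$\int_{\mathbb{T}}|u_0|^2\,dx\lesssim\int_0^T\bigl(|u(t_1+t,x_1-v_1t)|^2+|u(t_2+t,x_2-v_2t)|^2\bigr)\,dt$$ holds for all solutions $u$ of the linear KdV equation $\partial_tu+\partial_x^3u=0$, $u(0,x)=u_0(x)\in L^2(\mathbb{T})$, if $v_1$ and $v_2$ satisfy (1) $v_2>4v_1>0$, or (2) there exists a prime $p\equiv2\pmod 3$ such that $\mathrm{ord}_p(v_1)\ne\mathrm{ord}_p(v_2)$.
   Context: $\mathbb{T}=\mathbb{R}/2\pi\mathbb{Z}$. For a prime $p$ and an integer $v$, $\mathrm{ord}_p(v)$ denotes the largest integer $m$ such that $p^m\mid v$. For $u_0=\sum_{k\in\mathbb{Z}}c_ke^{ikx}\in L^2(\mathbb{T})$ the solution of the linear KdV equation is $u(t,x)=\sum_{k\in\mathbb{Z}}c_ke^{ik^3t}e^{ikx}$, and its restriction to a line is given by the series $u(t_0+t,x_0-vt)=\sum_{k\in\mathbb{Z}}c_ke^{i(k^3t_0+kx_0)}e^{i(k^3-kv)t}$. $A\lesssim B$ means $A\le CB$ with a constant $C>0$ independent of the solution $u$ (it may depend on $v_i,T$ and other data). *)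

theory Defs
  imports "HOL-Analysis.Analysis" "HOL-Library.Extended_Nat" "HOL-Number_Theory.Cong"
begin

definition L2_on :: "real set \<Rightarrow> (real \<Rightarrow> complex) set" where
  "L2_on S = {f. f \<in> borel_measurable (lebesgue_on S) \<and>
                 integrable (lebesgue_on S) (\<lambda>x. (cmod (f x))\<^sup>2)}"

(* Functions on the circle R/(2 pi Z) are represented by 2 pi-periodic functions on the real
   line, and points of the circle by real representatives. *)
definition L2_torus :: "(real \<Rightarrow> complex) set" where
  "L2_torus = {f. (\<forall>x. f (x + 2 * pi) = f x) \<and> f \<in> L2_on {0..2 * pi}}"

definition fourier_coeff :: "(real \<Rightarrow> complex) \<Rightarrow> int \<Rightarrow> complex" where
  "fourier_coeff f k =
     (LINT x|lebesgue_on {0..2 * pi}. f x * cis (- (real_of_int k * x))) / (2 * pi)"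

(* Symmetric partial sums of the solution
     u(t,x) = sum over k in Z of c_k e^(i k^3 t) e^(i k x)
   of u_t + u_xxx = 0, u(0,x) = u_0(x); recall cis y = e^(i y). *)
definition kdv_partial_sum :: "(real \<Rightarrow> complex) \<Rightarrow> nat \<Rightarrow> real \<Rightarrow> real \<Rightarrow> complex" where
  "kdv_partial_sum u0 N t x =
     (\<Sum>k = - int N..int N. fourier_coeff u0 k * cis (real_of_int k ^ 3 * t) * cis (real_of_int k * x))"

(* The restriction t |-> u(t0 + t, x0 - v t) of the solution to a line.  For u0 merely in L2,
   u has no pointwise values on a null set such as a line; the restriction is the function given
   by the series
     sum over k in Z of c_k e^(i (k^3 t0 + k x0)) e^(i (k^3 - k v) t),
   whose partial sums are those of u evaluated along the line, with convergence in L2 on every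
   bounded time interval.  This determines it up to equality almost everywhere.  The condition
   that f is in L2_on {a..b} also ensures that the integrals tending to 0 are genuine ones, and
   not the default value 0 of a divergent integral. *)
definition kdv_on_line :: "(real \<Rightarrow> complex) \<Rightarrow> real \<Rightarrow> real \<Rightarrow> int \<Rightarrow> real \<Rightarrow> complex" where
  "kdv_on_line u0 t0 x0 v =
     (SOME f. \<forall>a b. f \<in> L2_on {a..b} \<and>
        (\<lambda>N. LINT t|lebesgue_on {a..b}.
               (cmod (kdv_partial_sum u0 N (t0 + t) (x0 - real_of_int v * t) - f t))\<^sup>2)
          \<longlonglongrightarrow> 0)"

(* Every power of p divides 0, so the order of 0 is infinite; note that multiplicity p 0 = 0. *)
definition ord_at :: "nat \<Rightarrow> int \<Rightarrow> enat" where
  "ord_at p v = (if v = 0 then \<infinity> else enat (multiplicity (int p) v))"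

end

(* Along the line x = x0 - v t the solution is a trigonometric series with the integer frequencies
   k^3 - k v.  Their gaps tend to infinity once coincidences are removed, so an Ingham inequality
   holds on every interval (0,T): the observation on the line controls the sum over all frequencies
   n of the squared modulus of the sum of the coefficients with k^3 - k v = n.  Two indices k and l
   collide exactly when k = l or k^2 + k l + l^2 = v, which affects finitely many indices only.
   Both arithmetic conditions say that, up to exchanging the lines, a frequency of the first line
   is shared by at most one index that collides with another one on the second line: in case (1)
   by the size of the form k^2 + k l + l^2, in case (2) because p is inert in the Eisenstein
   integers, so that p^n dividing the form forces p^(ceil(n/2)) to divide both k and l.  Then the
   second line determines the coefficients without collision there, and the first line determines
   the remaining ones. *)
theory Submission
  imports Defs "HOL-Number_Theory.Residues"
begin

section \<open>The resonance set of the frequencies\<close>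

text \<open>The weighted test behind the Ingham inequality tolerates off-diagonal terms only up to
  half of the diagonal one, so it reaches only frequencies whose gaps are large in terms of T. The
  finitely many others are added one by one, each at the price of an arbitrarily small extension of
  the interval; hence \<open>observable\<close> carries the time as a parameter. A second difficulty
  is that a line is a null set: the restrictions are L2 limits picked by a choice operator, and
  nothing is known about them until the partial sums are shown to converge on every bounded interval
  to one and the same function. All estimates are therefore made for finite sums, with constants
  independent of the truncation, and the limit is taken at the end. Returning from coefficients to
  the integral of |u0|^2 takes completeness of the exponentials on the circle, derived here from
  Stone-Weierstrass. Comparisons rest on |x + y|^2 <= 2 |x|^2 + 2 |y|^2, so the constants are not
  sharp, only independent of u0.\<close>

definition freq :: "int \<Rightarrow> int \<Rightarrow> int" where
  "freq v k = k ^ 3 - k * v"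

definition resonant :: "int \<Rightarrow> int \<Rightarrow> bool" where
  "resonant v k \<longleftrightarrow> (\<exists>l. l \<noteq> k \<and> freq v l = freq v k)"

lemma abs_le_square_int: "\<bar>k\<bar> \<le> k\<^sup>2" for k :: int
  using self_le_power[of "\<bar>k\<bar>" 2] by (cases "k = 0") auto

lemma freq_eq_iff: "freq v k = freq v l \<longleftrightarrow> k = l \<or> k\<^sup>2 + k * l + l\<^sup>2 = v"
proof -
  have "freq v k - freq v l = (k - l) * (k\<^sup>2 + k * l + l\<^sup>2 - v)"
    by (simp add: freq_def power2_eq_square power3_eq_cube algebra_simps)
  then show ?thesis
    by (metis eq_iff_diff_eq_0 mult_eq_0_iff)
qed

lemma resonant_iff: "resonant v k \<longleftrightarrow> (\<exists>l. l \<noteq> k \<and> k\<^sup>2 + k * l + l\<^sup>2 = v)"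
proof -
  have "freq v l = freq v k \<longleftrightarrow> k\<^sup>2 + k * l + l\<^sup>2 = v" if "l \<noteq> k" for l
    using that freq_eq_iff[of v k l] by auto
  then show ?thesis by (auto simp: resonant_def)
qed

lemma resonant_bound:
  assumes "resonant v k"
  shows "3 * k\<^sup>2 \<le> 4 * v"
proof -
  obtain m where "k\<^sup>2 + k * m + m\<^sup>2 = v"
    using assms unfolding resonant_iff by blast
  then have "4 * v = 3 * k\<^sup>2 + (k + 2 * m)\<^sup>2"
    by (simp add: power2_eq_square algebra_simps)
  then show ?thesis by simp
qed

lemma resonant_subset: "{k. resonant v k} \<subseteq> {- 2 * \<bar>v\<bar>..2 * \<bar>v\<bar>}"
proof
  fix k assume "k \<in> {k. resonant v k}"
  then have *: "3 * k\<^sup>2 \<le> 4 * v" by (simp add: resonant_bound)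
  with abs_le_square_int[of k] show "k \<in> {- 2 * \<bar>v\<bar>..2 * \<bar>v\<bar>}" by auto
qed

lemma finite_resonant: "finite {k. resonant v k}"
  by (rule finite_subset[OF resonant_subset]) simp

text \<open>Bounds the size of all fibres of \<open>freq v\<close> at once, uniformly in k; this is
  what \<open>exponential_series_L2\<close> asks for, with the resonance set as exceptional
  set.\<close>

lemma freq_fibre_subset: "{l. freq v l = freq v k} \<subseteq> insert k {l. resonant v l}"
proof
  fix l assume "l \<in> {l. freq v l = freq v k}"
  then show "l \<in> insert k {l. resonant v l}"
    by (cases "l = k") (auto simp: resonant_def intro!: exI[of _ k])
qed

section \<open>Divisibility of the form k^2 + k l + l^2 by powers of a prime that is 2 modulo
  3\<close>

lemma prime_dvd_norm_form:
  fixes p :: nat and k l :: int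
  assumes p: "prime p" "[p = 2] (mod 3)" and dvd: "int p dvd k\<^sup>2 + k * l + l\<^sup>2"
  shows "int p dvd k"
proof (rule ccontr)
  assume nk: "\<not> int p dvd k"
  have pi: "prime (int p)" using p by simp
  have nl: "\<not> int p dvd l"
  proof
    assume "int p dvd l"
    then have "int p dvd k * l + l\<^sup>2" by (simp add: power2_eq_square)
    then have "int p dvd k\<^sup>2"
      using dvd by (metis add.assoc dvd_add_left_iff)
    with nk pi show False using prime_dvd_power by blast
  qed
  define m where "m = p div 3"
  have pm: "p = 3 * m + 2"
    using p(2) unfolding m_def cong_def by presburger
  have cop: "coprime x (int p)" if "\<not> int p dvd x" for x
    using prime_imp_coprime[OF pi that] by (simp add: coprime_commute)
  \<comment> \<open>Cubing is injective on the units modulo p: since p - 1 = 3m + 1, the inverse of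
    x is (x^3)^m. So k^3 = l^3 forces k = l modulo p, and the form becomes 3 k^2.\<close>
  have cube: "[k ^ 3 = l ^ 3] (mod int p)"
  proof -
    have "k ^ 3 - l ^ 3 = (k - l) * (k\<^sup>2 + k * l + l\<^sup>2)"
      by (simp add: power2_eq_square power3_eq_cube algebra_simps)
    then show ?thesis using dvd by (simp add: cong_iff_dvd_diff)
  qed
  have fermat: "[x * (x ^ 3) ^ m = 1] (mod int p)" if "\<not> int p dvd x" for x
  proof -
    interpret residues "int p" "residue_ring (int p)"
      by unfold_locales (use prime_gt_1_nat[OF p(1)] in simp_all)
    have "[x ^ (p - 1) = 1] (mod int p)"
      using euler_theorem[OF cop[OF that]] totient_prime[OF p(1)] by simp
    moreover have "p - 1 = Suc (3 * m)" using pm by simp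
    ultimately show ?thesis by (simp add: power_mult)
  qed
  have "[k * (k ^ 3) ^ m = l * (k ^ 3) ^ m] (mod int p)"
  proof -
    have "[l * (k ^ 3) ^ m = l * (l ^ 3) ^ m] (mod int p)"
      by (intro cong_mult cong_pow cube cong_refl)
    then show ?thesis
      using fermat[OF nk] fermat[OF nl] by (meson cong_sym cong_trans)
  qed
  moreover have "coprime ((k ^ 3) ^ m) (int p)"
    using cop[OF nk] by simp
  ultimately have "[k = l] (mod int p)"
    by (simp add: cong_mult_rcancel)
  then have "[k\<^sup>2 + k * k + k\<^sup>2 = k\<^sup>2 + k * l + l\<^sup>2] (mod int p)"
    by (intro cong_add cong_mult cong_pow cong_refl)
  then have "int p dvd k\<^sup>2 + k * k + k\<^sup>2"
    using dvd by (simp only: cong_dvd_iff)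
  then have "int p dvd 3 * k\<^sup>2"
    by (simp add: power2_eq_square)
  moreover have "\<not> int p dvd 3"
  proof
    assume "int p dvd 3"
    then have "int p \<le> 3" using zdvd_imp_le by fastforce
    then have "p = 2" using pm by presburger
    with \<open>int p dvd 3\<close> show False by simp
  qed
  ultimately have "int p dvd k\<^sup>2" using pi prime_dvd_mult_iff by blast
  with nk pi show False using prime_dvd_power by blast
qed

text \<open>Descent by two: p divides both variables, so p^2 splits off the form and one factor p
  off k. At n = 1 the odd leftover still yields one factor; that case stands apart because
  \<open>n - 2\<close> would be truncated.\<close>

lemma prime_power_dvd_norm_form:
  fixes p :: nat and k l :: int
  assumes p: "prime p" "[p = 2] (mod 3)" and "int p ^ n dvd k\<^sup>2 + k * l + l\<^sup>2"
  shows "int p ^ ((n + 1) div 2) dvd k"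
  using assms(3)
proof (induction n arbitrary: k l rule: less_induct)
  case (less n)
  have p0: "int p \<noteq> 0" using p(1) by auto
  show ?case
  proof (cases "n = 0")
    case False
    have d: "int p dvd k\<^sup>2 + k * l + l\<^sup>2"
      using less.prems False by (meson dvd_power dvd_trans gr0I)
    obtain k' l' where kl: "k = int p * k'" "l = int p * l'"
      using prime_dvd_norm_form[OF p d] prime_dvd_norm_form[OF p, of l k] d
      by (metis add.commute add.left_commute dvdE mult.commute)
    show ?thesis
    proof (cases "n = 1")
      case True
      then show ?thesis using kl by simp
    next
      case n: False
      with False have n2: "n = Suc (Suc (n - 2))" by simp
      have "k\<^sup>2 + k * l + l\<^sup>2 = int p ^ 2 * (k'\<^sup>2 + k' * l' + l'\<^sup>2)"
        by (simp add: kl power2_eq_square algebra_simps)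
      moreover have "int p ^ n = int p ^ 2 * int p ^ (n - 2)"
        using n2 by (metis power_add add_2_eq_Suc)
      ultimately have "int p ^ (n - 2) dvd k'\<^sup>2 + k' * l' + l'\<^sup>2"
        using less.prems p0 by simp
      then have "int p ^ ((n - 2 + 1) div 2) dvd k'"
        using less.IH[of "n - 2"] n2 by simp
      then have "int p * int p ^ ((n - 2 + 1) div 2) dvd k"
        by (simp add: kl)
      moreover have "(n + 1) div 2 = Suc ((n - 2 + 1) div 2)" using n2 by presburger
      ultimately show ?thesis by simp
    qed
  qed simp
qed

text \<open>Origin of the 4 in condition (1): a collision gives 2v = k^2 + l^2 + (k + l)^2 <= 3 k^2
  + 3 l^2, and each of these two terms is at most 4w by \<open>resonant_bound\<close>.\<close>

lemma no_shared_resonance_small: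
  assumes "4 * w < v" "resonant w k" "resonant w l" "freq v k = freq v l"
  shows "k = l"
proof (rule ccontr)
  assume "k \<noteq> l"
  then have "2 * v = k\<^sup>2 + l\<^sup>2 + (k + l)\<^sup>2"
    using assms(4) by (simp add: freq_eq_iff power2_eq_square algebra_simps)
  also have "\<dots> \<le> 3 * (k\<^sup>2 + l\<^sup>2)"
    using zero_le_power2[of "k - l"] by (simp add: power2_eq_square algebra_simps)
  also have "\<dots> \<le> 8 * w"
    using resonant_bound[OF assms(2)] resonant_bound[OF assms(3)] by simp
  finally show False using assms(1) by simp
qed

text \<open>All indices resonant for w are divisible by p^e with 2e >= n, where p^n divides w but
  not v. A collision of two of them on the other line would make v, as a value of a quadratic form,
  divisible by p^(2e).\<close>

lemma no_shared_resonance_prime: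
  assumes p: "prime p" "[p = 2] (mod 3)" and ord: "ord_at p v < ord_at p w"
    and res: "resonant w k" "resonant w l" and eq: "freq v k = freq v l"
  shows "k = l"
proof (rule ccontr)
  assume kl: "k \<noteq> l"
  have v0: "v \<noteq> 0" using ord by (auto simp: ord_at_def)
  define n where "n = Suc (multiplicity (int p) v)"
  \<comment> \<open>For w = 0 the order is infinite and the divisibility is trivial.\<close>
  have w: "int p ^ n dvd w"
  proof (cases "w = 0")
    case False
    then have "n \<le> multiplicity (int p) w"
      using ord v0 by (simp add: ord_at_def n_def)
    then show ?thesis by (rule multiplicity_dvd')
  qed simp
  define e where "e = (n + 1) div 2"
  have dvd: "int p ^ e dvd j" if r: "resonant w j" for j
  proof -
    obtain m where "j\<^sup>2 + j * m + m\<^sup>2 = w"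
      using r unfolding resonant_iff by blast
    then show ?thesis
      using prime_power_dvd_norm_form[OF p, of n j m] w by (simp add: e_def)
  qed
  have "(int p ^ e)\<^sup>2 dvd k\<^sup>2 + k * l + l\<^sup>2"
    using dvd[OF res(1)] dvd[OF res(2)] by (auto simp: power2_eq_square intro!: dvd_add mult_dvd_mono)
  then have "int p ^ (2 * e) dvd v"
    using eq kl by (simp add: freq_eq_iff power_mult[symmetric] mult.commute)
  moreover have "n \<le> 2 * e" by (simp add: e_def)
  ultimately have "int p ^ n dvd v" using power_le_dvd by blast
  moreover have "\<not> is_unit (int p)" using p(1) by auto
  ultimately show False
    using v0 unfolding n_def by (simp add: power_dvd_iff_le_multiplicity del: power_Suc)
qed

section \<open>Observability of trigonometric sums\<close>

definition trig_sum :: "int set \<Rightarrow> (int \<Rightarrow> complex) \<Rightarrow> real \<Rightarrow> complex" where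
  "trig_sum F a t = (\<Sum>n\<in>F. a n * cis (of_int n * t))"

lemma continuous_on_trig_sum [continuous_intros]:
  "continuous_on S f \<Longrightarrow> continuous_on S (\<lambda>t. trig_sum F a (f t))"
  unfolding trig_sum_def by (intro continuous_intros)

lemma has_integral_cis:
  fixes a b r :: real
  assumes "a \<le> b" "r \<noteq> 0"
  shows "((\<lambda>t. cis (r * t)) has_integral (cis (r * b) - cis (r * a)) / (\<i> * r)) {a..b}"
proof -
  have "((\<lambda>t. exp (\<i> * r * complex_of_real t) / (\<i> * r)) has_vector_derivative
           exp (\<i> * r * complex_of_real t)) (at t within {a..b})" for t
    by (rule has_vector_derivative_real_field) (use assms(2) in \<open>auto intro!: derivative_eq_intros\<close>)
  then have "((\<lambda>t. exp (\<i> * r * complex_of_real t)) has_integral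
      (exp (\<i> * r * complex_of_real b) / (\<i> * r) - exp (\<i> * r * complex_of_real a) / (\<i> * r))) {a..b}"
    using assms(1) by (intro fundamental_theorem_of_calculus) auto
  then show ?thesis
    by (simp add: cis_conv_exp diff_divide_distrib mult.assoc)
qed

lemma norm_trig_sum_square:
  "complex_of_real ((cmod (trig_sum F a t))\<^sup>2) =
     (\<Sum>n\<in>F. \<Sum>m\<in>F. a n * cnj (a m) * cis (of_int (n - m) * t))"
proof -
  have "complex_of_real ((cmod (trig_sum F a t))\<^sup>2) = trig_sum F a t * cnj (trig_sum F a t)"
    by (rule complex_norm_square)
  also have "\<dots> = (\<Sum>n\<in>F. \<Sum>m\<in>F. (a n * cis (of_int n * t)) * (cnj (a m) * cis (- (of_int m * t))))"
    by (simp add: trig_sum_def sum_product cis_cnj)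
  also have "\<dots> = (\<Sum>n\<in>F. \<Sum>m\<in>F. a n * cnj (a m) * (cis (of_int n * t) * cis (- (of_int m * t))))"
    by (simp add: algebra_simps)
  also have "\<dots> = (\<Sum>n\<in>F. \<Sum>m\<in>F. a n * cnj (a m) * cis (of_int (n - m) * t))"
    by (simp only: cis_mult) (simp add: algebra_simps)
  finally show ?thesis .
qed

section \<open>Parseval over whole periods and the upper bound on any interval\<close>

lemma cis_orthogonality:
  "((\<lambda>t. cis (of_int k * t)) has_integral (if k = 0 then 2 * pi * real N else 0)) {x..x + 2 * pi * real N}"
proof (cases "k = 0")
  case True
  then show ?thesis
    using has_integral_const_real[of "1::complex" x "x + 2 * pi * real N"]
    by (simp add: scaleR_conv_of_real mult.assoc)
next
  case False
  have "cis (of_int k * (x + 2 * pi * real N)) = cis (of_int k * x) * cis (2 * pi * of_int (k * int N))"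
    by (simp add: cis_mult algebra_simps)
  then have "cis (of_int k * (x + 2 * pi * real N)) = cis (of_int k * x)"
    by (simp add: cis_multiple_2pi)
  then show ?thesis
    using has_integral_cis[of x "x + 2 * pi * real N" "of_int k"] False by simp
qed

lemma trig_sum_Parseval:
  assumes "finite F"
  shows "integral {x..x + 2 * pi * real N} (\<lambda>t. (cmod (trig_sum F a t))\<^sup>2)
    = 2 * pi * real N * (\<Sum>n\<in>F. (cmod (a n))\<^sup>2)"
proof -
  let ?I = "{x..x + 2 * pi * real N}"
  have "((\<lambda>t. complex_of_real ((cmod (trig_sum F a t))\<^sup>2)) has_integral
      (\<Sum>n\<in>F. \<Sum>m\<in>F. a n * cnj (a m) * (if n - m = 0 then 2 * pi * real N else 0))) ?I"
    unfolding norm_trig_sum_square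
    by (intro has_integral_sum has_integral_mult_right cis_orthogonality assms)
  also have "(\<Sum>n\<in>F. \<Sum>m\<in>F. a n * cnj (a m) * (if n - m = 0 then 2 * pi * real N else 0)) =
      (\<Sum>n\<in>F. a n * cnj (a n) * (2 * pi * real N))"
  proof (rule sum.cong[OF refl])
    fix n assume "n \<in> F"
    have "(\<Sum>m\<in>F. a n * cnj (a m) * (if n - m = 0 then 2 * pi * real N else 0)) =
       (\<Sum>m\<in>F. if n = m then a n * cnj (a n) * (2 * pi * real N) else 0)"
      by (rule sum.cong) auto
    then show "(\<Sum>m\<in>F. a n * cnj (a m) * (if n - m = 0 then 2 * pi * real N else 0)) =
        a n * cnj (a n) * (2 * pi * real N)"
      using \<open>n \<in> F\<close> assms by (simp add: sum.delta')
  qed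
  also have "\<dots> = of_real (2 * pi * real N * (\<Sum>n\<in>F. (cmod (a n))\<^sup>2))"
    by (simp add: complex_norm_square[symmetric] sum_distrib_left mult.commute)
  finally have "((\<lambda>t. Re (complex_of_real ((cmod (trig_sum F a t))\<^sup>2))) has_integral
      Re (of_real (2 * pi * real N * (\<Sum>n\<in>F. (cmod (a n))\<^sup>2)))) ?I"
    by (rule has_integral_Re)
  then show ?thesis by (simp add: integral_unique)
qed

lemma trig_sum_square_integrable:
  "(\<lambda>t. (cmod (trig_sum F a t))\<^sup>2) integrable_on {x..y}"
  by (intro integrable_continuous_interval continuous_intros)

text \<open>Covering the interval by whole periods, where Parseval is exact, gives a K that depends
  on the interval alone.\<close>

lemma trig_sum_upper_bound:
  fixes x y :: real
  shows "\<exists>K\<ge>0. \<forall>F a. finite F \<longrightarrow>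
    integral {x..y} (\<lambda>t. (cmod (trig_sum F a t))\<^sup>2) \<le> K * (\<Sum>n\<in>F. (cmod (a n))\<^sup>2)"
proof -
  obtain N where N: "y - x \<le> real N" using real_arch_simple by blast
  have "real N \<le> 2 * pi * real N"
    using pi_ge_two by (simp add: mult_le_cancel_right1)
  then have "{x..y} \<subseteq> {x..x + 2 * pi * real N}" using N by auto
  then have "integral {x..y} (\<lambda>t. (cmod (trig_sum F a t))\<^sup>2) \<le> 2 * pi * real N * (\<Sum>n\<in>F. (cmod (a n))\<^sup>2)"
    if "finite F" for F a
    unfolding trig_sum_Parseval[OF that, of x, symmetric]
    by (intro integral_subset_le trig_sum_square_integrable) auto
  then show ?thesis by (intro exI[of _ "2 * pi * real N"]) auto
qed

text \<open>The lower half of Ingham's inequality for the family L, with one constant for all finite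
  subfamilies, so that convergence questions are kept out of it.\<close>

definition observable :: "real \<Rightarrow> int set \<Rightarrow> bool" where
  "observable T L \<longleftrightarrow> (\<exists>C>0. \<forall>F a. finite F \<longrightarrow> F \<subseteq> L \<longrightarrow>
     (\<Sum>n\<in>F. (cmod (a n))\<^sup>2) \<le> C * integral {0..T} (\<lambda>t. (cmod (trig_sum F a t))\<^sup>2))"

lemma observable_mono:
  assumes "observable S L" "S \<le> T" "M \<subseteq> L"
  shows "observable T M"
proof -
  obtain C where C: "C > 0" "\<And>F a. finite F \<Longrightarrow> F \<subseteq> L \<Longrightarrow>
     (\<Sum>n\<in>F. (cmod (a n))\<^sup>2) \<le> C * integral {0..S} (\<lambda>t. (cmod (trig_sum F a t))\<^sup>2)"
    using assms(1) by (auto simp: observable_def)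
  have "(\<Sum>n\<in>F. (cmod (a n))\<^sup>2) \<le> C * integral {0..T} (\<lambda>t. (cmod (trig_sum F a t))\<^sup>2)"
    if "finite F" "F \<subseteq> M" for F a
  proof -
    have "integral {0..S} (\<lambda>t. (cmod (trig_sum F a t))\<^sup>2) \<le> integral {0..T} (\<lambda>t. (cmod (trig_sum F a t))\<^sup>2)"
      using assms(2) by (intro integral_subset_le trig_sum_square_integrable) auto
    then show ?thesis
      using C(2)[of F a] C(1) that assms(3) by (meson mult_left_mono less_imp_le order_trans)
  qed
  then show ?thesis using C(1) by (auto simp: observable_def)
qed

section \<open>Ingham's inequality for widely spaced frequencies\<close>

lemma weighted_cis_integral:
  fixes T r :: real
  assumes T: "0 \<le> T" and r: "1 \<le> \<bar>r\<bar>"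
  obtains I where "((\<lambda>t. of_real (t * (T - t)) * cis (r * t)) has_integral I) {0..T}"
    and "cmod I \<le> (2 * T + 4) / r\<^sup>2"
proof -
  define z where "z = \<i> * complex_of_real r"
  have z0: "z \<noteq> 0" using r by (auto simp: z_def)
  \<comment> \<open>Antiderivative found by repeated integration by parts. The weight vanishes at
    both ends, so only the terms in z^-2 and z^-3 survive in the boundary values.\<close>
  define G :: "complex \<Rightarrow> complex" where "G x = exp (z * x) * (x * (T - x) / z - (T - 2 * x) / z\<^sup>2 - 2 / z ^ 3)" for x :: complex
  have "(G has_field_derivative exp (z * x) * (x * (of_real T - x))) (at x)" for x
    unfolding G_def by (rule derivative_eq_intros refl | (simp add: z0; fail))+
      (use z0 in \<open>simp add: field_simps power2_eq_square power3_eq_cube\<close>)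
  then have "((\<lambda>t. G (of_real t)) has_vector_derivative exp (z * complex_of_real t) * (complex_of_real t * (complex_of_real T - complex_of_real t))) (at t within {0..T})" for t
    by (rule has_vector_derivative_real_field)
  then have "((\<lambda>t. exp (z * complex_of_real t) * (complex_of_real t * (complex_of_real T - complex_of_real t))) has_integral (G (of_real T) - G (of_real 0))) {0..T}"
    using T by (intro fundamental_theorem_of_calculus) auto
  moreover have "exp (z * complex_of_real t) * (complex_of_real t * (complex_of_real T - complex_of_real t)) = of_real (t * (T - t)) * cis (r * t)" for t
    by (simp add: z_def cis_conv_exp mult.assoc)
  ultimately have "((\<lambda>t. of_real (t * (T - t)) * cis (r * t)) has_integral (G (of_real T) - G (of_real 0))) {0..T}"
    by simp
  moreover have "cmod (G (of_real T) - G (of_real 0)) \<le> (2 * T + 4) / r\<^sup>2"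
  proof -
    have re: "Re z = 0" by (simp add: z_def)
    have nz: "cmod z = \<bar>r\<bar>" by (simp add: z_def norm_mult)
    have inv: "1 / \<bar>r\<bar> ^ 3 \<le> 1 / r\<^sup>2"
      using r power_increasing[of 2 3 "\<bar>r\<bar>"] by (intro divide_left_mono) auto
    have "cmod (G (of_real T)) \<le> T / r\<^sup>2 + 2 / \<bar>r\<bar> ^ 3"
    proof -
      have "cmod (G (of_real T)) = cmod (T / z\<^sup>2 - 2 / z ^ 3)"
        by (simp add: G_def norm_mult re)
      also have "\<dots> \<le> cmod (T / z\<^sup>2) + cmod (2 / z ^ 3)" by (rule norm_triangle_ineq4)
      finally show ?thesis using T by (simp add: norm_divide norm_power nz)
    qed
    moreover have "cmod (G (of_real 0)) \<le> T / r\<^sup>2 + 2 / \<bar>r\<bar> ^ 3"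
    proof -
      have "cmod (G (of_real 0)) = cmod (- (T / z\<^sup>2) - 2 / z ^ 3)"
        by (simp add: G_def)
      also have "\<dots> \<le> cmod (- (T / z\<^sup>2)) + cmod (2 / z ^ 3)" by (rule norm_triangle_ineq4)
      finally show ?thesis using T by (simp add: norm_divide norm_power nz)
    qed
    ultimately have "cmod (G (of_real T) - G (of_real 0)) \<le> 2 * (T / r\<^sup>2 + 2 * (1 / \<bar>r\<bar> ^ 3))"
      using norm_triangle_ineq4[of "G (of_real T)" "G (of_real 0)"] by simp
    also have "\<dots> \<le> 2 * (T / r\<^sup>2 + 2 * (1 / r\<^sup>2))"
      using inv by simp
    finally show ?thesis by (simp add: add_divide_distrib)
  qed
  ultimately show thesis by (rule that)
qed

lemma weight_integral:
  fixes T :: real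
  assumes "0 \<le> T"
  shows "((\<lambda>t. complex_of_real (t * (T - t))) has_integral of_real (T ^ 3 / 6)) {0..T}"
proof -
  have "((\<lambda>t. T * t\<^sup>2 / 2 - t ^ 3 / 3) has_vector_derivative t * (T - t)) (at t within {0..T})" for t
    by (auto intro!: derivative_eq_intros
        simp: has_real_derivative_iff_has_vector_derivative[symmetric] field_simps power2_eq_square)
  then have "((\<lambda>t. t * (T - t)) has_integral ((T * T\<^sup>2 / 2 - T ^ 3 / 3) - (T * 0\<^sup>2 / 2 - 0 ^ 3 / 3))) {0..T}"
    using assms by (intro fundamental_theorem_of_calculus) auto
  moreover have "(T * T\<^sup>2 / 2 - T ^ 3 / 3) - (T * 0\<^sup>2 / 2 - 0 ^ 3 / 3) = T ^ 3 / 6"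
    by (simp add: power2_eq_square power3_eq_cube)
  ultimately have "((\<lambda>t. t * (T - t)) has_integral T ^ 3 / 6) {0..T}" by simp
  then show ?thesis using has_integral_of_real by blast
qed

text \<open>Tests against the weight \<open>t * (T - t)\<close>, whose Fourier transform decays quadratically. The
  diagonal term of \<open>sparse\<close> vanishes because \<open>1 / 0 = 0\<close>.\<close>
lemma observable_sparse:
  fixes T e :: real
  assumes T: "0 < T" and e: "(2 * T + 4) * e \<le> T ^ 3 / 12"
    and sparse: "\<And>F n. finite F \<Longrightarrow> F \<subseteq> L \<Longrightarrow> n \<in> F \<Longrightarrow> (\<Sum>m\<in>F. 1 / (real_of_int (n - m))\<^sup>2) \<le> e"
  shows "observable T L"
proof -
  define w where "w t = t * (T - t)" for t :: real
  define W where "W k = integral {0..T} (\<lambda>t. of_real (w t) * cis (of_int k * t))" for k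
  have W: "((\<lambda>t. of_real (w t) * cis (of_int k * t)) has_integral W k) {0..T}" for k
    unfolding W_def w_def by (intro integrable_integral integrable_continuous_interval continuous_intros)
  \<comment> \<open>At k = 0 both sides are 0: the integral is exactly T^3 / 6, and 1 / 0 =
    0.\<close>
  have W_bound: "cmod (W k - (if k = 0 then of_real (T ^ 3 / 6) else 0)) \<le> (2 * T + 4) * (1 / (real_of_int k)\<^sup>2)" for k
  proof (cases "k = 0")
    case True
    then have "W k = of_real (T ^ 3 / 6)"
      using weight_integral[of T] T by (simp add: W_def w_def integral_unique)
    then show ?thesis using True by simp
  next
    case False
    then have "1 \<le> \<bar>k\<bar>" by linarith
    then have "real_of_int 1 \<le> real_of_int \<bar>k\<bar>" by (simp only: of_int_le_iff)
    then have "1 \<le> \<bar>real_of_int k\<bar>" by simp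
    then obtain I where I: "((\<lambda>t. of_real (t * (T - t)) * cis (of_int k * t)) has_integral I) {0..T}"
      "cmod I \<le> (2 * T + 4) / (real_of_int k)\<^sup>2"
      using weighted_cis_integral[of T "of_int k"] T
      by (metis less_imp_le)
    then have "W k = I" by (simp add: W_def w_def integral_unique)
    then show ?thesis using I False by simp
  qed
  \<comment> \<open>Origin of 12 / T: the off-diagonal part takes at most half of the diagonal T^3 /
    6, leaving T^3 / 12, while the weight is at most T^2.\<close>
  have "(\<Sum>n\<in>F. (cmod (a n))\<^sup>2) \<le> 12 / T * integral {0..T} (\<lambda>t. (cmod (trig_sum F a t))\<^sup>2)"
    if F: "finite F" "F \<subseteq> L" for F a
  proof -
    define A where "A = (\<Sum>n\<in>F. (cmod (a n))\<^sup>2)"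
    define X where "X = integral {0..T} (\<lambda>t. w t * (cmod (trig_sum F a t))\<^sup>2)"
    define d where "d n m = 1 / (real_of_int (n - m))\<^sup>2" for n m
    have d: "0 \<le> d n m" "d n m = d m n" for n m
      by (simp_all add: d_def power2_commute)
    have X: "((\<lambda>t. w t * (cmod (trig_sum F a t))\<^sup>2) has_integral X) {0..T}"
      unfolding X_def w_def by (intro integrable_integral integrable_continuous_interval continuous_intros)
    have "((\<lambda>t. of_real (w t * (cmod (trig_sum F a t))\<^sup>2)) has_integral complex_of_real X) {0..T}"
      by (intro has_integral_of_real X)
    moreover have "of_real (w t * (cmod (trig_sum F a t))\<^sup>2) =
      (\<Sum>n\<in>F. \<Sum>m\<in>F. a n * cnj (a m) * (of_real (w t) * cis (of_int (n - m) * t)))" for t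
      by (simp only: of_real_mult norm_trig_sum_square sum_distrib_left) (simp add: algebra_simps)
    moreover have "((\<lambda>t. \<Sum>n\<in>F. \<Sum>m\<in>F. a n * cnj (a m) * (of_real (w t) * cis (of_int (n - m) * t)))
        has_integral (\<Sum>n\<in>F. \<Sum>m\<in>F. a n * cnj (a m) * W (n - m))) {0..T}"
      by (intro has_integral_sum has_integral_mult_right W F)
    ultimately have X_eq: "complex_of_real X = (\<Sum>n\<in>F. \<Sum>m\<in>F. a n * cnj (a m) * W (n - m))"
      using has_integral_unique by (metis (no_types, lifting) has_integral_cong)
    have diag: "(\<Sum>n\<in>F. \<Sum>m\<in>F. a n * cnj (a m) * (if n - m = 0 then of_real (T ^ 3 / 6) else 0)) = of_real (T ^ 3 / 6 * A)"
    proof -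
      have "(\<Sum>m\<in>F. a n * cnj (a m) * (if n - m = 0 then of_real (T ^ 3 / 6) else 0)) = of_real (T ^ 3 / 6 * (cmod (a n))\<^sup>2)"
        if "n \<in> F" for n
      proof -
        have "(\<Sum>m\<in>F. a n * cnj (a m) * (if n - m = 0 then complex_of_real (T ^ 3 / 6) else 0)) =
            (\<Sum>m\<in>F. if n = m then a n * cnj (a n) * of_real (T ^ 3 / 6) else 0)"
          by (rule sum.cong) auto
        then show ?thesis
          using that F by (simp add: sum.delta' complex_norm_square del: of_real_power)
      qed
      then show ?thesis
        unfolding A_def sum_distrib_left of_real_sum by (intro sum.cong refl)
    qed
    have "cmod (complex_of_real X - of_real (T ^ 3 / 6 * A))
        \<le> (\<Sum>n\<in>F. \<Sum>m\<in>F. cmod (a n) * cmod (a m) * ((2 * T + 4) * d n m))"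
    proof -
      have "complex_of_real X - of_real (T ^ 3 / 6 * A) =
        (\<Sum>n\<in>F. \<Sum>m\<in>F. a n * cnj (a m) * (W (n - m) - (if n - m = 0 then of_real (T ^ 3 / 6) else 0)))"
        unfolding X_eq diag[symmetric] by (simp only: sum_subtractf right_diff_distrib)
      also have "cmod \<dots> \<le> (\<Sum>n\<in>F. \<Sum>m\<in>F. cmod (a n) * cmod (a m) * ((2 * T + 4) * d n m))"
        unfolding d_def by (intro sum_norm_le) (use W_bound in \<open>auto simp only: norm_mult complex_mod_cnj intro!: mult_left_mono mult_nonneg_nonneg norm_ge_zero\<close>)
      finally show ?thesis .
    qed
    \<comment> \<open>Schur test: the product is replaced by half the sum of squares; as d is
      symmetric, both halves agree after swapping the sums, and only row sums of d remain.\<close>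
    also have "\<dots> \<le> (\<Sum>n\<in>F. \<Sum>m\<in>F. ((cmod (a n))\<^sup>2 + (cmod (a m))\<^sup>2) / 2 * ((2 * T + 4) * d n m))"
    proof (intro sum_mono mult_right_mono)
      fix n m
      show "cmod (a n) * cmod (a m) \<le> ((cmod (a n))\<^sup>2 + (cmod (a m))\<^sup>2) / 2"
        using sum_squares_bound[of "cmod (a n)" "cmod (a m)"] by simp
      show "0 \<le> (2 * T + 4) * d n m" using d T by simp
    qed
    also have "\<dots> = (\<Sum>n\<in>F. \<Sum>m\<in>F. (cmod (a n))\<^sup>2 / 2 * ((2 * T + 4) * d n m)) + (\<Sum>n\<in>F. \<Sum>m\<in>F. (cmod (a m))\<^sup>2 / 2 * ((2 * T + 4) * d n m))"
      by (simp add: sum.distrib add_divide_distrib distrib_right)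
    also have "(\<Sum>n\<in>F. \<Sum>m\<in>F. (cmod (a m))\<^sup>2 / 2 * ((2 * T + 4) * d n m)) = (\<Sum>n\<in>F. \<Sum>m\<in>F. (cmod (a n))\<^sup>2 / 2 * ((2 * T + 4) * d n m))"
      by (subst sum.swap) (simp add: d(2))
    also have "(\<Sum>n\<in>F. \<Sum>m\<in>F. (cmod (a n))\<^sup>2 / 2 * ((2 * T + 4) * d n m)) + (\<Sum>n\<in>F. \<Sum>m\<in>F. (cmod (a n))\<^sup>2 / 2 * ((2 * T + 4) * d n m))
       = (\<Sum>n\<in>F. (cmod (a n))\<^sup>2 * ((2 * T + 4) * (\<Sum>m\<in>F. d n m)))"
      by (simp only: sum.distrib[symmetric] sum_distrib_left distrib_right[symmetric] mult.assoc field_sum_of_halves)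
    also have "\<dots> \<le> (\<Sum>n\<in>F. (cmod (a n))\<^sup>2 * (T ^ 3 / 12))"
    proof (intro sum_mono mult_left_mono)
      fix n assume "n \<in> F"
      then have "(\<Sum>m\<in>F. d n m) \<le> e" using sparse[OF F] by (simp add: d_def)
      then have "(2 * T + 4) * (\<Sum>m\<in>F. d n m) \<le> (2 * T + 4) * e" using T by (intro mult_left_mono) auto
      then show "(2 * T + 4) * (\<Sum>m\<in>F. d n m) \<le> T ^ 3 / 12" using e by linarith
    qed auto
    also have "\<dots> = T ^ 3 / 12 * A" by (simp add: A_def sum_distrib_left mult.commute)
    finally have "cmod (of_real (X - T ^ 3 / 6 * A)) \<le> T ^ 3 / 12 * A" by simp
    then have "T ^ 3 / 12 * A \<le> X" by (simp only: norm_of_real)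
    also have "X \<le> integral {0..T} (\<lambda>t. T\<^sup>2 * (cmod (trig_sum F a t))\<^sup>2)"
      unfolding X_def
    proof (rule integral_le)
      show "(\<lambda>t. w t * (cmod (trig_sum F a t))\<^sup>2) integrable_on {0..T}" using X by blast
      show "(\<lambda>t. T\<^sup>2 * (cmod (trig_sum F a t))\<^sup>2) integrable_on {0..T}"
        by (intro integrable_continuous_interval continuous_intros)
      fix t assume "t \<in> {0..T}"
      then have "w t \<le> T\<^sup>2" unfolding w_def power2_eq_square by (intro mult_mono) auto
      then show "w t * (cmod (trig_sum F a t))\<^sup>2 \<le> T\<^sup>2 * (cmod (trig_sum F a t))\<^sup>2"
        by (intro mult_right_mono) auto
    qed
    finally have "T ^ 3 / 12 * A \<le> T\<^sup>2 * integral {0..T} (\<lambda>t. (cmod (trig_sum F a t))\<^sup>2)" by simp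
    then have "T\<^sup>2 * (T / 12 * A) \<le> T\<^sup>2 * integral {0..T} (\<lambda>t. (cmod (trig_sum F a t))\<^sup>2)"
      by (simp add: power2_eq_square power3_eq_cube)
    then have "T / 12 * A \<le> integral {0..T} (\<lambda>t. (cmod (trig_sum F a t))\<^sup>2)"
      using T by simp
    then show ?thesis using T by (simp add: A_def field_simps)
  qed
  then show ?thesis
    using T unfolding observable_def by (intro exI[of _ "12 / T"]) auto
qed

text \<open>The induction carries the remainder 2 / (R + 1) of the telescoping bound 1 / j^2 <= 1 /
  (j - 1) - 1 / j; the term j = 0 is 1 / 0 = 0.\<close>

lemma sum_inverse_squares_int:
  assumes "finite (S :: int set)"
  shows "(\<Sum>j\<in>S. 1 / (real_of_int j)\<^sup>2) \<le> 4"
proof -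
  have *: "(\<Sum>j=-int (Suc R)..int (Suc R). 1 / (real_of_int j)\<^sup>2) \<le> 4 - 2 / real (Suc R)" for R
  proof (induction R)
    case 0
    have "{-1..1::int} = {-1,0,1}" by auto
    then show ?case by simp
  next
    case (Suc R)
    have "{-int (Suc (Suc R))..int (Suc (Suc R))} =
        insert (-int (Suc (Suc R))) (insert (int (Suc (Suc R))) {-int (Suc R)..int (Suc R)})"
      by auto
    moreover have "-int (Suc (Suc R)) \<notin> insert (int (Suc (Suc R))) {-int (Suc R)..int (Suc R)}"
      "int (Suc (Suc R)) \<notin> {-int (Suc R)..int (Suc R)}"
      by auto
    ultimately have "(\<Sum>j=-int (Suc (Suc R))..int (Suc (Suc R)). 1 / (real_of_int j)\<^sup>2) =
       2 / (real (Suc (Suc R)))\<^sup>2 + (\<Sum>j=-int (Suc R)..int (Suc R). 1 / (real_of_int j)\<^sup>2)"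
      by (simp del: of_nat_Suc)
    also have "\<dots> \<le> 2 / (real (Suc (Suc R)))\<^sup>2 + (4 - 2 / real (Suc R))"
      using Suc.IH by simp
    also have "\<dots> \<le> 4 - 2 / real (Suc (Suc R))"
    proof -
      have "2 / (real (Suc (Suc R)))\<^sup>2 \<le> 2 / (real (Suc R) * real (Suc (Suc R)))"
        unfolding power2_eq_square by (intro divide_left_mono mult_right_mono mult_pos_pos) auto
      also have "\<dots> = 2 / real (Suc R) - 2 / real (Suc (Suc R))"
        by (simp add: field_simps)
      finally show ?thesis by simp
    qed
    finally show ?case .
  qed
  obtain B where B: "\<And>j. j \<in> S \<Longrightarrow> \<bar>j\<bar> \<le> B"
    using finite_imageI[OF assms, of abs] by (meson Max_ge imageI)
  have "S \<subseteq> {-int (Suc (nat B))..int (Suc (nat B))}"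
  proof
    fix j assume "j \<in> S"
    then show "j \<in> {-int (Suc (nat B))..int (Suc (nat B))}" using B[of j] by auto
  qed
  then have "(\<Sum>j\<in>S. 1 / (real_of_int j)\<^sup>2) \<le> (\<Sum>j=-int (Suc (nat B))..int (Suc (nat B)). 1 / (real_of_int j)\<^sup>2)"
    by (intro sum_mono2) auto
  also have "\<dots> \<le> 4 - 2 / real (Suc (nat B))" by (rule *)
  also have "\<dots> \<le> 4" by simp
  finally show ?thesis .
qed

text \<open>Far out, frequencies are at least M times as far apart as their indices, so each row sum
  is at most M^-2 times a sum of inverse squares of integers, that is 4 / M^2. A large M makes this
  admissible in \<open>observable_sparse\<close>.\<close>

lemma observable_freq_tail:
  fixes T :: real
  assumes T: "0 < T"
  shows "\<exists>N. observable T (freq v ` {k. N \<le> \<bar>k\<bar>})"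
proof -
  \<comment> \<open>48 = 4 * 12 comes from the requirement (2T + 4) * 4 / M^2 <= T^3 / 12; the extra
    1 gives M >= 1 and hence M <= M^2.\<close>
  obtain M :: nat where M: "48 * (2 * T + 4) / T ^ 3 + 1 \<le> real M" using real_arch_simple by blast
  have pos: "0 \<le> 48 * (2 * T + 4) / T ^ 3" using T by simp
  then have M1: "1 \<le> real M" using M by linarith
  \<comment> \<open>If |k| >= N, then 4 (k^2 + k l + l^2) >= 3 k^2 >= 3 |k| >= 6 (M + |v|) for every
    l, so subtracting v from the form leaves at least M.\<close>
  define N where "N = 2 * (int M + \<bar>v\<bar>)"
  have gap: "real M * \<bar>real_of_int (k - l)\<bar> \<le> \<bar>real_of_int (freq v k - freq v l)\<bar>"
    if "N \<le> \<bar>k\<bar>" for k l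
  proof -
    have M0: "0 \<le> int M" by simp
    define q where "q = k\<^sup>2 + k * l + l\<^sup>2"
    have "4 * q = 3 * k\<^sup>2 + (k + 2 * l)\<^sup>2"
      unfolding q_def by (simp add: power2_eq_square algebra_simps)
    then have "6 * (int M + \<bar>v\<bar>) \<le> 4 * q"
      using that abs_le_square_int[of k] zero_le_power2[of "k + 2 * l"] unfolding N_def by linarith
    then have "int M \<le> k\<^sup>2 + k * l + l\<^sup>2 - v"
      unfolding q_def[symmetric] using M0 by presburger
    then have "int M * \<bar>k - l\<bar> \<le> \<bar>k - l\<bar> * \<bar>k\<^sup>2 + k * l + l\<^sup>2 - v\<bar>"
      by (subst mult.commute) (intro mult_left_mono, auto)
    also have "\<dots> = \<bar>freq v k - freq v l\<bar>"
      unfolding abs_mult[symmetric] by (simp add: freq_def power2_eq_square power3_eq_cube algebra_simps)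
    finally have "real_of_int (int M * \<bar>k - l\<bar>) \<le> real_of_int \<bar>freq v k - freq v l\<bar>"
      by (simp only: of_int_le_iff)
    then show ?thesis by simp
  qed
  have "observable T (freq v ` {k. N \<le> \<bar>k\<bar>})"
  proof (rule observable_sparse[OF T, where e = "4 / (real M)\<^sup>2"])
    have "48 * (2 * T + 4) / T ^ 3 \<le> (real M)\<^sup>2"
      using M M1 self_le_power[of "real M" 2] by linarith
    then show "(2 * T + 4) * (4 / (real M)\<^sup>2) \<le> T ^ 3 / 12"
      using T M1 by (simp add: field_simps)
  next
    fix F n assume F: "finite F" "F \<subseteq> freq v ` {k. N \<le> \<bar>k\<bar>}" "n \<in> F"
    then obtain K where K: "finite K" "K \<subseteq> {k. N \<le> \<bar>k\<bar>}" "F = freq v ` K"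
      using finite_subset_image by metis
    then obtain k where k: "k \<in> K" "n = freq v k" using F(3) by blast
    have "(\<Sum>m\<in>F. 1 / (real_of_int (n - m))\<^sup>2) \<le> (\<Sum>l\<in>K. 1 / (real_of_int (n - freq v l))\<^sup>2)"
      unfolding K(3) using sum_image_le[OF K(1), of "\<lambda>m. 1 / (real_of_int (n - m))\<^sup>2" "freq v"]
      by (simp add: o_def)
    also have "\<dots> \<le> (\<Sum>l\<in>K. 1 / (real M)\<^sup>2 * (1 / (real_of_int (k - l))\<^sup>2))"
    proof (rule sum_mono)
      fix l assume "l \<in> K"
      show "1 / (real_of_int (n - freq v l))\<^sup>2 \<le> 1 / (real M)\<^sup>2 * (1 / (real_of_int (k - l))\<^sup>2)"
      \<comment> \<open>On the diagonal both sides are 1 / 0 = 0.\<close>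
      proof (cases "k = l")
        case False
        have "(real M * \<bar>real_of_int (k - l)\<bar>)\<^sup>2 \<le> (real_of_int (n - freq v l))\<^sup>2"
          using gap[of k l] k K(2) by (simp only: k(2)) (intro iffD2[OF abs_le_square_iff[symmetric]], auto simp: abs_mult)
        moreover have "0 < (real M * \<bar>real_of_int (k - l)\<bar>)\<^sup>2" using False M1 by simp
        ultimately have "1 / (real_of_int (n - freq v l))\<^sup>2 \<le> 1 / (real M * \<bar>real_of_int (k - l)\<bar>)\<^sup>2"
          by (intro divide_left_mono mult_pos_pos) auto
        then show ?thesis by (simp add: power_mult_distrib)
      qed (use k in simp)
    qed
    also have "\<dots> = 1 / (real M)\<^sup>2 * (\<Sum>l\<in>K. 1 / (real_of_int (k - l))\<^sup>2)"
      by (simp only: sum_distrib_left)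
    also have "(\<Sum>l\<in>K. 1 / (real_of_int (k - l))\<^sup>2) = (\<Sum>j\<in>(\<lambda>l. k - l) ` K. 1 / (real_of_int j)\<^sup>2)"
      by (subst sum.reindex) (auto simp: inj_on_def)
    also have "1 / (real M)\<^sup>2 * \<dots> \<le> 1 / (real M)\<^sup>2 * 4"
      using K(1) by (intro mult_left_mono sum_inverse_squares_int) auto
    finally show "(\<Sum>m\<in>F. 1 / (real_of_int (n - m))\<^sup>2) \<le> 4 / (real M)\<^sup>2" by simp
  qed
  then show ?thesis by blast
qed

section \<open>Adding finitely many frequencies at the cost of a little time\<close>

lemma abs_sin_mult_le:
  fixes x :: real
  shows "\<bar>sin (of_int n * x)\<bar> \<le> \<bar>of_int n\<bar> * \<bar>sin x\<bar>"
proof -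
  have *: "\<bar>sin (real m * x)\<bar> \<le> real m * \<bar>sin x\<bar>" for m
  proof (induction m)
    case (Suc m)
    have "\<bar>sin (real (Suc m) * x)\<bar> = \<bar>sin (real m * x) * cos x + cos (real m * x) * sin x\<bar>"
    proof -
      have "real (Suc m) * x = real m * x + x" by (simp add: algebra_simps)
      then show ?thesis by (simp only: sin_add)
    qed
    also have "\<dots> \<le> \<bar>sin (real m * x)\<bar> * \<bar>cos x\<bar> + \<bar>cos (real m * x)\<bar> * \<bar>sin x\<bar>"
      by (metis abs_mult abs_triangle_ineq)
    also have "\<dots> \<le> \<bar>sin (real m * x)\<bar> * 1 + 1 * \<bar>sin x\<bar>"
      by (intro add_mono mult_mono abs_cos_le_one) auto
    also have "\<dots> \<le> real (Suc m) * \<bar>sin x\<bar>" using Suc.IH by (simp add: distrib_right)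
    finally show ?case .
  qed simp
  show ?thesis
  proof (cases "0 \<le> n")
    case True
    then show ?thesis using *[of "nat n"] by simp
  next
    case False
    then show ?thesis using *[of "nat (- n)"] by simp
  qed
qed

text \<open>The strictness, which makes the constant \<open>c\<close> of
  \<open>observable_insert\<close> positive, comes from |cos (x / 2)| < 1 in sin x = 2 sin (x / 2)
  cos (x / 2).\<close>

lemma abs_sin_less:
  fixes x :: real
  assumes "0 < x"
  shows "\<bar>sin x\<bar> < x"
proof (cases "x \<le> 1")
  case True
  have "cos (x / 2) < cos 0"
    using assms True pi_ge_two by (intro cos_monotone_0_pi) auto
  moreover have "0 \<le> cos (x / 2)"
    using assms True pi_ge_two by (intro cos_ge_zero) auto
  ultimately have "\<bar>cos (x / 2)\<bar> < 1" by simp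
  moreover have "\<bar>sin x\<bar> = 2 * \<bar>sin (x / 2)\<bar> * \<bar>cos (x / 2)\<bar>"
    using sin_double[of "x / 2"] by (simp add: abs_mult)
  moreover have "2 * \<bar>sin (x / 2)\<bar> \<le> x"
    using abs_sin_x_le_abs_x[of "x / 2"] assms by simp
  ultimately show ?thesis
    using assms mult_right_mono[of "2 * \<bar>sin (x / 2)\<bar>" x "\<bar>cos (x / 2)\<bar>"]
      mult_strict_left_mono[of "\<bar>cos (x / 2)\<bar>" 1 x] by linarith
next
  case False
  then show ?thesis using abs_sin_le_one[of x] by linarith
qed

text \<open>The combination \<open>f t - cis (- \<mu> * s) * f (t + s)\<close> removes the frequency \<open>\<mu>\<close>; averaging over \<open>s\<close>
  bounds the factors \<open>\<bar>1 - cis ((n - \<mu>) * s)\<bar>\<^sup>2\<close> at the other frequencies from below uniformly in \<open>n\<close>.\<close>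
lemma observable_insert:
  fixes T d :: real
  assumes obs: "observable T L" and T: "0 \<le> T" and d: "0 < d"
  shows "observable (T + d) (insert \<mu> L)"
proof -
  obtain C where C: "C > 0" "\<And>F a. finite F \<Longrightarrow> F \<subseteq> L \<Longrightarrow>
     (\<Sum>n\<in>F. (cmod (a n))\<^sup>2) \<le> C * integral {0..T} (\<lambda>t. (cmod (trig_sum F a t))\<^sup>2)"
    using obs by (auto simp: observable_def)
  obtain K where K: "0 \<le> K" "\<And>F a. finite F \<Longrightarrow>
    integral {0..T + d} (\<lambda>t. (cmod (trig_sum F a t))\<^sup>2) \<le> K * (\<Sum>n\<in>F. (cmod (a n))\<^sup>2)"
    using trig_sum_upper_bound by blast
  \<comment> \<open>A lower bound for the integral of |1 - cis (k s)|^2 over {0..d}, which is 2d - 2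
    sin (k d) / k; it holds for all nonzero integers k because |sin (k d)| <= |k| |sin d|.\<close>
  define c where "c = 2 * (d - \<bar>sin d\<bar>)"
  have c: "0 < c"
    using abs_sin_less[OF d] by (simp add: c_def)
  have cis_integral: "((\<lambda>s. (cmod (1 - cis (of_int k * s)))\<^sup>2) has_integral 2 * d - 2 * sin (of_int k * d) / of_int k) {0..d}"
    if "k \<noteq> 0" for k
  proof -
    have "((\<lambda>s. 2 * s - 2 * sin (of_int k * s) / of_int k) has_vector_derivative (cmod (1 - cis (of_int k * s)))\<^sup>2) (at s within {0..d})" for s
    proof -
      have "(cmod (1 - cis x))\<^sup>2 = 2 - 2 * cos x" for x
        unfolding cmod_power2 using sin_cos_squared_add[of x] by (simp add: power2_eq_square algebra_simps)
      then show ?thesis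
        using that by (auto intro!: derivative_eq_intros simp: has_real_derivative_iff_has_vector_derivative[symmetric])
    qed
    then have "((\<lambda>s. (cmod (1 - cis (of_int k * s)))\<^sup>2) has_integral
      ((2 * d - 2 * sin (of_int k * d) / of_int k) - (2 * 0 - 2 * sin (of_int k * 0) / of_int k))) {0..d}"
      using d by (intro fundamental_theorem_of_calculus) auto
    then show ?thesis by simp
  qed
  have cis_lower: "c \<le> 2 * d - 2 * sin (of_int k * d) / of_int k" if "k \<noteq> 0" for k
  proof -
    have "sin (of_int k * d) / of_int k \<le> \<bar>sin (of_int k * d)\<bar> / \<bar>of_int k\<bar>"
      by (metis abs_divide abs_ge_self)
    also have "\<dots> \<le> \<bar>sin d\<bar>"
      using abs_sin_mult_le[of k d] that by (simp add: field_simps)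
    finally show ?thesis by (simp add: c_def)
  qed
  \<comment> \<open>B controls the coefficients other than that of \<mu>: averaging over s shows
    that c times their energy is at most 4 C I d. The second summand of C' pays for \<mu>
    itself.\<close>
  define B where "B = 4 * C * d / c"
  define C' where "C' = B + (2 + 2 * K * B) / (T + d)"
  have B: "0 < B" using C c d by (simp add: B_def)
  have "(\<Sum>n\<in>F. (cmod (a n))\<^sup>2) \<le> C' * integral {0..T + d} (\<lambda>t. (cmod (trig_sum F a t))\<^sup>2)"
    if F: "finite F" "F \<subseteq> insert \<mu> L" for F a
  proof -
    define I where "I = integral {0..T + d} (\<lambda>t. (cmod (trig_sum F a t))\<^sup>2)"
    define G where "G = F - {\<mu>}"
    have G: "finite G" "G \<subseteq> L" using F by (auto simp: G_def)
    have sub: "integral {x..y} (\<lambda>t. (cmod (trig_sum F a t))\<^sup>2) \<le> I" if "0 \<le> x" "y \<le> T + d" for x y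
      unfolding I_def using that by (intro integral_subset_le trig_sum_square_integrable) auto
    have I0: "0 \<le> I" unfolding I_def by (intro integral_nonneg trig_sum_square_integrable) auto
    have shifted: "(\<Sum>n\<in>G. (cmod (a n))\<^sup>2 * (cmod (1 - cis (of_int (n - \<mu>) * s)))\<^sup>2) \<le> 4 * C * I"
      if s: "s \<in> {0..d}" for s
    proof -
      let ?b = "\<lambda>n. a n * (1 - cis (of_int (n - \<mu>) * s))"
      have "(\<Sum>n\<in>G. (cmod (?b n))\<^sup>2) \<le> C * integral {0..T} (\<lambda>t. (cmod (trig_sum G ?b t))\<^sup>2)"
        by (rule C(2)[OF G])
      also have "\<dots> \<le> C * (4 * I)"
      proof (rule mult_left_mono)
        have eq: "trig_sum G ?b t = trig_sum F a t - cis (- (of_int \<mu> * s)) * trig_sum F a (t + s)" for t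
        proof -
          \<comment> \<open>The term of \<mu> may be added back since its factor 1 - cis 0
            vanishes.\<close>
          have "trig_sum G ?b t = (\<Sum>n\<in>F. ?b n * cis (of_int n * t))"
            unfolding trig_sum_def G_def using F(1) by (intro sum.mono_neutral_left) auto
          also have "\<dots> = (\<Sum>n\<in>F. a n * cis (of_int n * t) - cis (- (of_int \<mu> * s)) * (a n * cis (of_int n * (t + s))))"
          proof (rule sum.cong[OF refl])
            fix n
            have "cis (of_int (n - \<mu>) * s) * cis (of_int n * t) = cis (- (of_int \<mu> * s)) * cis (of_int n * (t + s))"
              by (simp add: cis_mult algebra_simps)
            then show "?b n * cis (of_int n * t) = a n * cis (of_int n * t) - cis (- (of_int \<mu> * s)) * (a n * cis (of_int n * (t + s)))"
              by (simp add: right_diff_distrib left_diff_distrib mult.assoc mult.left_commute)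
          qed
          finally show ?thesis by (simp add: trig_sum_def sum_subtractf sum_distrib_left)
        qed
        have "integral {0..T} (\<lambda>t. (cmod (trig_sum G ?b t))\<^sup>2) \<le>
            integral {0..T} (\<lambda>t. 2 * (cmod (trig_sum F a t))\<^sup>2 + 2 * (cmod (trig_sum F a (t + s)))\<^sup>2)"
        proof (rule integral_le)
          fix t assume "t \<in> {0..T}"
          have "cmod (trig_sum G ?b t) \<le> cmod (trig_sum F a t) + cmod (trig_sum F a (t + s))"
            unfolding eq by (rule order_trans[OF norm_triangle_ineq4]) (simp add: norm_mult)
          then have "(cmod (trig_sum G ?b t))\<^sup>2 \<le> (cmod (trig_sum F a t) + cmod (trig_sum F a (t + s)))\<^sup>2"
            by (intro power_mono) auto
          also have "\<dots> \<le> 2 * (cmod (trig_sum F a t))\<^sup>2 + 2 * (cmod (trig_sum F a (t + s)))\<^sup>2"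
            using sum_squares_bound[of "cmod (trig_sum F a t)" "cmod (trig_sum F a (t + s))"]
            by (simp add: power2_sum)
          finally show "(cmod (trig_sum G ?b t))\<^sup>2 \<le> 2 * (cmod (trig_sum F a t))\<^sup>2 + 2 * (cmod (trig_sum F a (t + s)))\<^sup>2" .
        qed (intro integrable_continuous_interval continuous_intros)+
        also have "\<dots> = 2 * integral {0..T} (\<lambda>t. (cmod (trig_sum F a t))\<^sup>2) + 2 * integral {0..T} (\<lambda>t. (cmod (trig_sum F a (t + s)))\<^sup>2)"
          by (subst integral_add) (auto intro!: integrable_continuous_interval continuous_intros)
        also have "integral {0..T} (\<lambda>t. (cmod (trig_sum F a (t + s)))\<^sup>2) = integral {0 + s..T + s} (\<lambda>t. (cmod (trig_sum F a t))\<^sup>2)"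
          by (subst integral_shift[symmetric]) (auto simp: o_def intro!: continuous_intros)
        \<comment> \<open>Both windows {0..T} and {s..T + s} lie in {0..T + d}, so each contributes
          at most 2 I.\<close>
        also have "2 * integral {0..T} (\<lambda>t. (cmod (trig_sum F a t))\<^sup>2) + 2 * integral {0 + s..T + s} (\<lambda>t. (cmod (trig_sum F a t))\<^sup>2) \<le> 4 * I"
          using sub[of 0 T] sub[of "0 + s" "T + s"] s d by auto
        finally show "integral {0..T} (\<lambda>t. (cmod (trig_sum G ?b t))\<^sup>2) \<le> 4 * I" .
      qed (use C in simp)
      finally show ?thesis by (simp add: norm_mult power_mult_distrib)
    qed
    have "((\<lambda>s. \<Sum>n\<in>G. (cmod (a n))\<^sup>2 * (cmod (1 - cis (of_int (n - \<mu>) * s)))\<^sup>2) has_integral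
       (\<Sum>n\<in>G. (cmod (a n))\<^sup>2 * (2 * d - 2 * sin (of_int (n - \<mu>) * d) / of_int (n - \<mu>)))) {0..d}"
      using G by (intro has_integral_sum has_integral_mult_right cis_integral) (auto simp: G_def)
    from has_integral_le[OF this has_integral_const_real, of "4 * C * I"] shifted
    have "(\<Sum>n\<in>G. (cmod (a n))\<^sup>2 * (2 * d - 2 * sin (of_int (n - \<mu>) * d) / of_int (n - \<mu>))) \<le> 4 * C * I * d"
      using d by (simp add: mult.commute)
    moreover have "(\<Sum>n\<in>G. (cmod (a n))\<^sup>2 * c) \<le> (\<Sum>n\<in>G. (cmod (a n))\<^sup>2 * (2 * d - 2 * sin (of_int (n - \<mu>) * d) / of_int (n - \<mu>)))"
      by (intro sum_mono mult_left_mono cis_lower) (auto simp: G_def)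
    ultimately have "(\<Sum>n\<in>G. (cmod (a n))\<^sup>2) * c \<le> 4 * C * I * d"
      by (simp add: sum_distrib_right)
    then have SG: "(\<Sum>n\<in>G. (cmod (a n))\<^sup>2) \<le> B * I"
      using c by (simp add: B_def field_simps)
    show ?thesis
    proof (cases "\<mu> \<in> F")
      case False
      then have "G = F" by (simp add: G_def)
      then have "(\<Sum>n\<in>F. (cmod (a n))\<^sup>2) \<le> B * I" using SG by simp
      also have "\<dots> \<le> C' * I"
        using I0 B K T d by (intro mult_right_mono) (auto simp: C'_def)
      finally show ?thesis by (simp add: I_def)
    next
      case True
      \<comment> \<open>The coefficient of \<mu> is isolated by subtraction: its monomial has
        constant modulus, and the energy of the rest is at most K times the coefficients already
        bounded.\<close>
      have split: "trig_sum F a t = a \<mu> * cis (of_int \<mu> * t) + trig_sum G a t" for t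
        unfolding trig_sum_def G_def using True F by (simp add: sum.remove)
      have "integral {0..T + d} (\<lambda>t. (cmod (a \<mu>))\<^sup>2) \<le>
          integral {0..T + d} (\<lambda>t. 2 * (cmod (trig_sum F a t))\<^sup>2 + 2 * (cmod (trig_sum G a t))\<^sup>2)"
      proof (rule integral_le)
        fix t assume "t \<in> {0..T + d}"
        have "cmod (a \<mu>) = cmod (a \<mu> * cis (of_int \<mu> * t))" by (simp add: norm_mult)
        also have "\<dots> = cmod (trig_sum F a t - trig_sum G a t)" by (simp add: split)
        also have "\<dots> \<le> cmod (trig_sum F a t) + cmod (trig_sum G a t)" by (rule norm_triangle_ineq4)
        finally have "(cmod (a \<mu>))\<^sup>2 \<le> (cmod (trig_sum F a t) + cmod (trig_sum G a t))\<^sup>2"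
          by (intro power_mono) auto
        also have "\<dots> \<le> 2 * (cmod (trig_sum F a t))\<^sup>2 + 2 * (cmod (trig_sum G a t))\<^sup>2"
          using sum_squares_bound[of "cmod (trig_sum F a t)" "cmod (trig_sum G a t)"]
          by (simp add: power2_sum)
        finally show "(cmod (a \<mu>))\<^sup>2 \<le> 2 * (cmod (trig_sum F a t))\<^sup>2 + 2 * (cmod (trig_sum G a t))\<^sup>2" .
      qed (intro integrable_continuous_interval continuous_intros)+
      also have "\<dots> = 2 * I + 2 * integral {0..T + d} (\<lambda>t. (cmod (trig_sum G a t))\<^sup>2)"
        unfolding I_def by (subst integral_add) (auto intro!: integrable_continuous_interval continuous_intros)
      also have "\<dots> \<le> 2 * I + 2 * (K * (B * I))"
        using K(2)[OF G(1), of a] mult_left_mono[OF SG K(1)] by linarith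
      finally have "(T + d) * (cmod (a \<mu>))\<^sup>2 \<le> (2 + 2 * K * B) * I"
        using T d by (simp add: algebra_simps)
      then have "(cmod (a \<mu>))\<^sup>2 \<le> (2 + 2 * K * B) / (T + d) * I"
        using T d by (simp add: field_simps)
      moreover have "(\<Sum>n\<in>F. (cmod (a n))\<^sup>2) = (cmod (a \<mu>))\<^sup>2 + (\<Sum>n\<in>G. (cmod (a n))\<^sup>2)"
        unfolding G_def using True F by (simp add: sum.remove)
      ultimately have "(\<Sum>n\<in>F. (cmod (a n))\<^sup>2) \<le> C' * I"
        using SG by (simp add: C'_def distrib_right)
      then show ?thesis by (simp add: I_def)
    qed
  qed
  moreover have "0 < C'"
    using B K T d unfolding C'_def by (intro add_pos_nonneg) auto
  ultimately show ?thesis unfolding observable_def by blast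
qed

text \<open>Seen from the last insertion backwards, each one uses half of the time still left above
  S, so finitely many insertions fit into any T > S.\<close>

lemma observable_Un:
  fixes T S :: real
  assumes "finite M" "observable S L" "0 \<le> S" "S < T"
  shows "observable T (M \<union> L)"
  using assms(1,4)
proof (induction M arbitrary: T rule: finite_induct)
  case empty
  then show ?case using observable_mono[OF assms(2)] by simp
next
  case (insert \<mu> M)
  have "observable ((S + T) / 2) (M \<union> L)" using insert by simp
  from observable_insert[OF this, of "(T - S) / 2" \<mu>]
  have "observable ((S + T) / 2 + (T - S) / 2) (insert \<mu> (M \<union> L))"
    using insert.prems assms(3) by simp
  moreover have "(S + T) / 2 + (T - S) / 2 = T" by (simp add: field_simps)
  ultimately show ?case by simp
qed

text \<open>Half of the time observes the sparse tail, the other half absorbs the finitely many low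
  frequencies.\<close>

theorem observable_freq:
  fixes T :: real
  assumes "0 < T"
  shows "observable T (range (freq v))"
proof -
  obtain N where N: "observable (T / 2) (freq v ` {k. N \<le> \<bar>k\<bar>})"
    using observable_freq_tail[of "T / 2" v] assms by auto
  have "{k. \<not> N \<le> \<bar>k\<bar>} \<subseteq> {- N..N}" by auto
  then have "finite {k. \<not> N \<le> \<bar>k\<bar>}" by (rule finite_subset) simp
  then have "observable T (freq v ` {k. \<not> N \<le> \<bar>k\<bar>} \<union> freq v ` {k. N \<le> \<bar>k\<bar>})"
    using N assms by (intro observable_Un[where S = "T / 2"]) auto
  moreover have "range (freq v) = freq v ` {k. \<not> N \<le> \<bar>k\<bar>} \<union> freq v ` {k. N \<le> \<bar>k\<bar>}" by auto
  ultimately show ?thesis by simp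
qed

section \<open>Completeness of square integrable functions\<close>

lemma borel_measurable_lebesgue_on:
  "f \<in> borel_measurable borel \<Longrightarrow> f \<in> borel_measurable (lebesgue_on S)"
  by (simp add: measurable_completion measurable_restrict_space1)

lemma cmod_square_le:
  fixes x y :: complex
  shows "(cmod x)\<^sup>2 \<le> 2 * (cmod (x - y))\<^sup>2 + 2 * (cmod y)\<^sup>2"
proof -
  have "cmod x \<le> cmod (x - y) + cmod y"
    using norm_triangle_ineq[of "x - y" y] by simp
  then have "(cmod x)\<^sup>2 \<le> (cmod (x - y) + cmod y)\<^sup>2"
    by (intro power_mono) auto
  then show ?thesis
    using sum_squares_bound[of "cmod (x - y)" "cmod y"] by (simp add: power2_sum)
qed

lemma integrable_cmod_square_le:
  fixes f g :: "real \<Rightarrow> complex"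
  assumes "integrable M (\<lambda>t. (cmod (f t - g t))\<^sup>2)" "integrable M (\<lambda>t. (cmod (g t))\<^sup>2)"
    and "f \<in> borel_measurable M"
  shows "integrable M (\<lambda>t. (cmod (f t))\<^sup>2)"
    and "(LINT t|M. (cmod (f t))\<^sup>2) \<le> 2 * (LINT t|M. (cmod (f t - g t))\<^sup>2) + 2 * (LINT t|M. (cmod (g t))\<^sup>2)"
proof -
  have int: "integrable M (\<lambda>t. 2 * (cmod (f t - g t))\<^sup>2 + 2 * (cmod (g t))\<^sup>2)"
    using assms by auto
  show *: "integrable M (\<lambda>t. (cmod (f t))\<^sup>2)"
    by (rule Bochner_Integration.integrable_bound[OF int]) (use assms(3) cmod_square_le in auto)
  have "(LINT t|M. (cmod (f t))\<^sup>2) \<le> (LINT t|M. 2 * (cmod (f t - g t))\<^sup>2 + 2 * (cmod (g t))\<^sup>2)"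
    by (intro integral_mono * int cmod_square_le)
  then show "(LINT t|M. (cmod (f t))\<^sup>2) \<le> 2 * (LINT t|M. (cmod (f t - g t))\<^sup>2) + 2 * (LINT t|M. (cmod (g t))\<^sup>2)"
    using assms by simp
qed

lemma integrable_cmod_square_diff:
  fixes f g :: "real \<Rightarrow> complex"
  assumes "integrable M (\<lambda>t. (cmod (f t))\<^sup>2)" "integrable M (\<lambda>t. (cmod (g t))\<^sup>2)"
    and [measurable]: "f \<in> borel_measurable M" "g \<in> borel_measurable M"
  shows "integrable M (\<lambda>t. (cmod (f t - g t))\<^sup>2)"
proof (rule Bochner_Integration.integrable_bound)
  show "integrable M (\<lambda>t. 2 * (cmod (f t))\<^sup>2 + 2 * (cmod (g t))\<^sup>2)" using assms by auto
  have "(cmod (f t - g t))\<^sup>2 \<le> 2 * (cmod (f t))\<^sup>2 + 2 * (cmod (g t))\<^sup>2" for t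
    using cmod_square_le[of "f t - g t" "- g t"] by simp
  then show "AE t in M. norm ((cmod (f t - g t))\<^sup>2) \<le> norm (2 * (cmod (f t))\<^sup>2 + 2 * (cmod (g t))\<^sup>2)"
    by simp
qed simp

lemma convergent_summable_increments:
  fixes h :: "nat \<Rightarrow> complex"
  assumes "summable (\<lambda>j. cmod (h (Suc j) - h j))"
  shows "convergent h"
proof -
  have "summable (\<lambda>j. h (Suc j) - h j)" using assms by (rule summable_norm_cancel)
  then have "(\<lambda>n. \<Sum>j<n. h (Suc j) - h j) \<longlonglongrightarrow> (\<Sum>j. h (Suc j) - h j)"
    by (rule summable_LIMSEQ)
  then have "(\<lambda>n. h n - h 0 + h 0) \<longlonglongrightarrow> (\<Sum>j. h (Suc j) - h j) + h 0"
    by (intro tendsto_add tendsto_const) (simp add: sum_lessThan_telescope)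
  then show ?thesis by (auto simp: convergent_def)
qed

text \<open>The limit has to be independent of the interval, so it is taken pointwise along a subsequence
  chosen from \<open>s\<close> alone.\<close>
lemma locally_L2_complete:
  fixes g :: "nat \<Rightarrow> real \<Rightarrow> complex" and s :: "nat \<Rightarrow> real"
  assumes cont: "\<And>N. continuous_on UNIV (g N)" and conv: "convergent s"
    and bound: "\<And>a b. \<exists>K\<ge>0. \<forall>M N. integral {a..b} (\<lambda>t. (cmod (g N t - g M t))\<^sup>2) \<le> K * \<bar>s N - s M\<bar>"
  obtains f where "\<And>a b. f \<in> L2_on {a..b}"
    and "\<And>a b. (\<lambda>N. LINT t|lebesgue_on {a..b}. (cmod (g N t - f t))\<^sup>2) \<longlonglongrightarrow> 0"
proof -
  obtain l where l: "s \<longlonglongrightarrow> l" using conv by (auto simp: convergent_def)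
  \<comment> \<open>The rate 8^-j still decays after the factor 2^j in the estimate of
    \<open>u j\<close> below. The indices \<open>r j\<close> may repeat; what matters is that s (r
    j) tends to l.\<close>
  have "\<exists>n. \<bar>s n - l\<bar> < (1 / 8) ^ j" for j
    using LIMSEQ_D[OF l, of "(1 / 8) ^ j"] by force
  then obtain r where r: "\<And>j. \<bar>s (r j) - l\<bar> < (1 / 8) ^ j" by metis
  have r_lim: "(\<lambda>j. s (r j)) \<longlonglongrightarrow> l"
  proof -
    have "(\<lambda>j. (1 / 8 :: real) ^ j) \<longlonglongrightarrow> 0" by (intro LIMSEQ_realpow_zero) auto
    then have "(\<lambda>j. s (r j) - l) \<longlonglongrightarrow> 0"
      by (rule Lim_null_comparison[rotated]) (use r in \<open>auto simp: less_imp_le\<close>)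
    then show ?thesis by (rule LIM_zero_cancel)
  qed
  define h where "h j = g (r j)" for j
  \<comment> \<open>Where \<open>h j t\<close> diverges, \<open>lim\<close> takes a default value;
    on each interval this concerns only a null set, as \<open>ae\<close> below shows.\<close>
  define f where "f t = lim (\<lambda>j. h j t)" for t
  have g_borel: "g N \<in> borel_measurable borel" for N
    using cont by (intro borel_measurable_continuous_onI)
  have [measurable]: "g N \<in> borel_measurable (lebesgue_on S)" "h N \<in> borel_measurable (lebesgue_on S)" for N S
    using g_borel by (auto simp: h_def borel_measurable_lebesgue_on)
  have "f \<in> borel_measurable borel"
    unfolding f_def h_def using g_borel by (intro borel_measurable_lim_metric)
  then have [measurable]: "f \<in> borel_measurable (lebesgue_on S)" for S
    by (rule borel_measurable_lebesgue_on)
  have main: "integrable (lebesgue_on {a..b}) (\<lambda>t. (cmod (g N t - f t))\<^sup>2) \<and>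
      (LINT t|lebesgue_on {a..b}. (cmod (g N t - f t))\<^sup>2) \<le> K * \<bar>s N - l\<bar>"
    if K: "0 \<le> K" "\<And>M N. integral {a..b} (\<lambda>t. (cmod (g N t - g M t))\<^sup>2) \<le> K * \<bar>s N - s M\<bar>" for a b K N
  proof -
    let ?M = "lebesgue_on {a..b}"
    have int: "integrable ?M \<phi>" "integral\<^sup>L ?M \<phi> = integral {a..b} \<phi>"
      if "continuous_on UNIV \<phi>" for \<phi> :: "real \<Rightarrow> real"
    proof -
      show "integrable ?M \<phi>"
        using that by (intro continuous_imp_integrable_real) (auto intro: continuous_on_subset)
      then show "integral\<^sup>L ?M \<phi> = integral {a..b} \<phi>"
        by (intro lebesgue_integral_eq_integral) auto
    qed
    have nn: "(\<integral>\<^sup>+ t. ennreal ((cmod (g m t - g n t))\<^sup>2) \<partial>?M) \<le> ennreal (K * \<bar>s m - s n\<bar>)" for m n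
    proof -
      have c: "continuous_on UNIV (\<lambda>t. (cmod (g m t - g n t))\<^sup>2)"
        using cont by (intro continuous_intros)
      have "(\<integral>\<^sup>+ t. ennreal ((cmod (g m t - g n t))\<^sup>2) \<partial>?M) = ennreal (integral {a..b} (\<lambda>t. (cmod (g m t - g n t))\<^sup>2))"
        using int[OF c] by (subst nn_integral_eq_integral) auto
      then show ?thesis using K(2) by (simp add: ennreal_leI)
    qed
    define \<mu> where "\<mu> = measure lebesgue {a..b}"
    define u where "u j t = cmod (h (Suc j) t - h j t)" for j t
    have [measurable]: "u j \<in> borel_measurable ?M" for j unfolding u_def by measurable
    have u_bound: "(\<integral>\<^sup>+ t. ennreal (u j t) \<partial>?M) \<le> ennreal ((\<mu> + K) * (1 / 2) ^ j)" for j
    proof -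
      have c: "continuous_on UNIV (\<lambda>t. (u j t)\<^sup>2)"
        unfolding u_def h_def using cont by (intro continuous_intros)
      have "\<bar>s (r (Suc j)) - s (r j)\<bar> \<le> (1 / 8) ^ Suc j + (1 / 8) ^ j"
        using r[of j] r[of "Suc j"] by linarith
      also have "\<dots> \<le> 2 * (1 / 8) ^ j" by simp
      finally have s_diff: "K * \<bar>s (r (Suc j)) - s (r j)\<bar> \<le> K * (2 * (1 / 8) ^ j)"
        using K(1) by (intro mult_left_mono)
      \<comment> \<open>The inequality u <= 2^-j / 2 + 2^j u^2 / 2 turns the L2 estimate into an L1
        estimate, summable in j, on an interval of finite length.\<close>
      have "(\<integral>\<^sup>+ t. ennreal (u j t) \<partial>?M) \<le> (\<integral>\<^sup>+ t. ennreal ((1 / 2) ^ j / 2 + 2 ^ j / 2 * (u j t)\<^sup>2) \<partial>?M)"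
      proof (intro nn_integral_mono ennreal_leI)
        fix t
        have "0 \<le> (2 ^ j * u j t - 1)\<^sup>2" by simp
        then have "2 * (2 ^ j * u j t) \<le> 1 + 2 ^ j * (2 ^ j * (u j t)\<^sup>2)"
          by (simp add: power2_diff power_mult_distrib power2_eq_square algebra_simps)
        then show "u j t \<le> (1 / 2) ^ j / 2 + 2 ^ j / 2 * (u j t)\<^sup>2"
          by (simp add: field_simps)
      qed
      also have "\<dots> = ennreal (LINT t|?M. (1 / 2) ^ j / 2 + 2 ^ j / 2 * (u j t)\<^sup>2)"
        using int(1)[OF c] by (intro nn_integral_eq_integral) auto
      also have "(LINT t|?M. (1 / 2) ^ j / 2 + 2 ^ j / 2 * (u j t)\<^sup>2) = \<mu> * (1 / 2) ^ j / 2 + 2 ^ j / 2 * integral {a..b} (\<lambda>t. (u j t)\<^sup>2)"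
        using int[OF c] by (simp add: \<mu>_def measure_restrict_space)
      also have "\<dots> \<le> \<mu> * (1 / 2) ^ j / 2 + 2 ^ j / 2 * (K * (2 * (1 / 8) ^ j))"
        using K(2)[of "r (Suc j)" "r j"] s_diff
        by (intro add_left_mono mult_left_mono) (auto simp: u_def h_def)
      also have "\<dots> \<le> (\<mu> + K) * (1 / 2) ^ j"
      proof -
        have "2 ^ j * (1 / 8) ^ j = (1 / 4 :: real) ^ j"
          by (simp only: power_mult_distrib[symmetric]) simp
        then have "2 ^ j / 2 * (K * (2 * (1 / 8) ^ j)) = K * (1 / 4 :: real) ^ j"
          by (simp add: mult.left_commute)
        also have "\<dots> \<le> K * (1 / 2) ^ j"
          using K(1) by (intro mult_left_mono power_mono) auto
        finally have "2 ^ j / 2 * (K * (2 * (1 / 8) ^ j)) \<le> K * (1 / 2) ^ j" .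
        moreover have "0 \<le> \<mu> * (1 / 2) ^ j" by (simp add: \<mu>_def)
        ultimately show ?thesis unfolding distrib_right by linarith
      qed
      finally show ?thesis by (simp add: ennreal_leI)
    qed
    have "(\<integral>\<^sup>+ t. (\<Sum>j. ennreal (u j t)) \<partial>?M) = (\<Sum>j. \<integral>\<^sup>+ t. ennreal (u j t) \<partial>?M)"
      by (rule nn_integral_suminf) simp
    also have "\<dots> \<le> (\<Sum>j. ennreal ((\<mu> + K) * (1 / 2) ^ j))"
      by (intro suminf_le u_bound) auto
    also have "\<dots> = ennreal (\<Sum>j. (\<mu> + K) * (1 / 2) ^ j)"
      using K(1) by (intro suminf_ennreal2 summable_mult summable_geometric) (auto simp: \<mu>_def)
    finally have "(\<integral>\<^sup>+ t. (\<Sum>j. ennreal (u j t)) \<partial>?M) \<noteq> \<infinity>"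
      by (auto simp: top_unique)
    then have "AE t in ?M. (\<Sum>j. ennreal (u j t)) \<noteq> \<infinity>"
      by (intro nn_integral_PInf_AE) auto
    then have ae: "AE t in ?M. (\<lambda>j. h j t) \<longlonglongrightarrow> f t"
    proof eventually_elim
      case (elim t)
      then have "summable (\<lambda>j. u j t)"
        by (intro summable_suminf_not_top) (auto simp: u_def)
      then have "convergent (\<lambda>j. h j t)"
        unfolding u_def by (rule convergent_summable_increments)
      then show ?case by (simp add: f_def convergent_LIMSEQ_iff)
    qed
    \<comment> \<open>Fatou's lemma along \<open>r\<close> bounds the distance from
      \<open>g N\<close> to f by the limit of the distances to \<open>h j\<close>.\<close>
    have "(\<integral>\<^sup>+ t. ennreal ((cmod (g N t - f t))\<^sup>2) \<partial>?M)
        = (\<integral>\<^sup>+ t. liminf (\<lambda>j. ennreal ((cmod (g N t - h j t))\<^sup>2)) \<partial>?M)"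
    proof (rule nn_integral_cong_AE, use ae in eventually_elim)
      case (elim t)
      then have "(\<lambda>j. ennreal ((cmod (g N t - h j t))\<^sup>2)) \<longlonglongrightarrow> ennreal ((cmod (g N t - f t))\<^sup>2)"
        by (intro tendsto_ennrealI tendsto_intros)
      then show ?case by (rule lim_imp_Liminf[OF trivial_limit_sequentially, symmetric])
    qed
    also have "\<dots> \<le> liminf (\<lambda>j. \<integral>\<^sup>+ t. ennreal ((cmod (g N t - h j t))\<^sup>2) \<partial>?M)"
      by (intro nn_integral_liminf) auto
    also have "\<dots> \<le> liminf (\<lambda>j. ennreal (K * \<bar>s N - s (r j)\<bar>))"
      unfolding h_def by (intro Liminf_mono always_eventually allI nn)
    also have "\<dots> = ennreal (K * \<bar>s N - l\<bar>)"
      by (intro lim_imp_Liminf tendsto_ennrealI tendsto_intros r_lim) auto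
    finally have fatou: "(\<integral>\<^sup>+ t. ennreal ((cmod (g N t - f t))\<^sup>2) \<partial>?M) \<le> ennreal (K * \<bar>s N - l\<bar>)" .
    then have "(\<integral>\<^sup>+ t. ennreal ((cmod (g N t - f t))\<^sup>2) \<partial>?M) < \<infinity>"
      by (auto intro: le_less_trans)
    then have "integrable ?M (\<lambda>t. (cmod (g N t - f t))\<^sup>2)"
      by (intro integrableI_bounded) auto
    moreover from this have "(LINT t|?M. (cmod (g N t - f t))\<^sup>2) \<le> K * \<bar>s N - l\<bar>"
      using fatou K(1) by (subst (asm) nn_integral_eq_integral) auto
    ultimately show ?thesis by blast
  qed
  show thesis
  proof
    fix a b
    obtain K where K: "0 \<le> K" "\<And>M N. integral {a..b} (\<lambda>t. (cmod (g N t - g M t))\<^sup>2) \<le> K * \<bar>s N - s M\<bar>"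
      using bound by blast
    note * = main[OF K]
    have "integrable (lebesgue_on {a..b}) (\<lambda>t. (cmod (g 0 t))\<^sup>2)"
      using cont by (intro continuous_imp_integrable_real continuous_intros) (auto intro: continuous_on_subset)
    with *[of 0] have "integrable (lebesgue_on {a..b}) (\<lambda>t. (cmod (f t))\<^sup>2)"
      by (intro integrable_cmod_square_le(1)[of _ f "g 0"]) (auto simp: norm_minus_commute)
    then show "f \<in> L2_on {a..b}" by (simp add: L2_on_def)
    show "(\<lambda>N. LINT t|lebesgue_on {a..b}. (cmod (g N t - f t))\<^sup>2) \<longlonglongrightarrow> 0"
    proof (rule tendsto_sandwich[OF _ _ tendsto_const])
      have "(\<lambda>N. K * \<bar>s N - l\<bar>) \<longlonglongrightarrow> K * \<bar>l - l\<bar>" by (intro tendsto_intros l)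
      then show "(\<lambda>N. K * \<bar>s N - l\<bar>) \<longlonglongrightarrow> 0" by simp
    qed (use * in auto)
  qed
qed

section \<open>Uniqueness of Fourier coefficients\<close>

inductive trig_poly :: "(real \<Rightarrow> complex) \<Rightarrow> bool" where
  monomial: "trig_poly (\<lambda>x. c * cis (of_int k * x))"
| add: "trig_poly p \<Longrightarrow> trig_poly q \<Longrightarrow> trig_poly (\<lambda>x. p x + q x)"

lemma trig_poly_const: "trig_poly (\<lambda>x. c)"
  using trig_poly.monomial[of c 0] by simp

lemma trig_poly_mult:
  assumes "trig_poly p" "trig_poly q"
  shows "trig_poly (\<lambda>x. p x * q x)"
  using assms(1)
proof induction
  case (monomial c k)
  from assms(2) show ?case
  proof induction
    case (monomial c' k')
    have "(\<lambda>x. c * cis (of_int k * x) * (c' * cis (of_int k' * x))) = (\<lambda>x. c * c' * cis (of_int (k + k') * x))"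
      by (rule ext) (simp add: cis_mult[symmetric] distrib_right)
    then show ?case using trig_poly.monomial[of "c * c'" "k + k'"] by metis
  next
    case (add p q)
    then show ?case by (simp add: distrib_left trig_poly.add)
  qed
next
  case (add p q)
  then show ?case by (simp add: distrib_right trig_poly.add)
qed

lemma trig_poly_continuous: "trig_poly p \<Longrightarrow> continuous_on S p"
  by (induction rule: trig_poly.induct) (intro continuous_intros; assumption?)+

text \<open>On the circle a real-linear functional p equals cos x times its value at 1 plus sin x
  times its value at the imaginary unit, a combination of cis x and cis (-x); sums and products stay
  in the class.\<close>

lemma trig_poly_real_polynomial:
  fixes p :: "complex \<Rightarrow> real"
  assumes "real_polynomial_function p"
  shows "trig_poly (\<lambda>x. of_real (p (cis x)))"
  using assms
proof induction
  case (linear p)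
  interpret bounded_linear p by fact
  have "complex_of_real (p (cis x)) =
    (of_real (p 1) / 2 + of_real (p \<i>) / (2 * \<i>)) * cis (of_int 1 * x) + (of_real (p 1) / 2 - of_real (p \<i>) / (2 * \<i>)) * cis (of_int (-1) * x)" for x
  proof -
    have "cis x = cos x *\<^sub>R 1 + sin x *\<^sub>R \<i>" by (simp add: complex_eq_iff)
    then have "p (cis x) = cos x * p 1 + sin x * p \<i>" by (metis add real_scaleR_def scaleR)
    then show ?thesis by (simp add: complex_eq_iff)
  qed
  then have "(\<lambda>x. complex_of_real (p (cis x))) = (\<lambda>x. (of_real (p 1) / 2 + of_real (p \<i>) / (2 * \<i>)) * cis (of_int 1 * x) + (of_real (p 1) / 2 - of_real (p \<i>) / (2 * \<i>)) * cis (of_int (-1) * x))"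
    by blast
  then show ?case by (simp only:) (rule trig_poly.add trig_poly.monomial)+
next
  case (const c)
  show ?case by (rule trig_poly_const)
next
  case (add p q)
  then show ?case by (simp add: trig_poly.add)
next
  case (mult p q)
  then show ?case by (simp add: trig_poly_mult)
qed

lemma trig_poly_polynomial:
  fixes p :: "complex \<Rightarrow> complex"
  assumes "polynomial_function p"
  shows "trig_poly (\<lambda>x. p (cis x))"
proof -
  have "real_polynomial_function (Re \<circ> p)" "real_polynomial_function (Im \<circ> p)"
    using assms bounded_linear_Re bounded_linear_Im unfolding polynomial_function_def by blast+
  from this[THEN trig_poly_real_polynomial]
  have "trig_poly (\<lambda>x. of_real (Re (p (cis x))) + \<i> * of_real (Im (p (cis x))))"
    by (intro trig_poly.add trig_poly_mult trig_poly_const) auto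
  then show ?thesis by (simp add: complex_eq[symmetric])
qed

text \<open>Stone-Weierstrass on the unit circle, where polynomials in the real and imaginary parts
  become trigonometric polynomials.\<close>

lemma trig_poly_approximation:
  fixes \<phi> :: "real \<Rightarrow> complex"
  assumes cont: "continuous_on {0..2 * pi} \<phi>" and per: "\<phi> (2 * pi) = \<phi> 0" and "e > 0"
  obtains p where "trig_poly p" "\<And>x. x \<in> {0..2 * pi} \<Longrightarrow> cmod (\<phi> x - p x) < e"
proof -
  define F where "F z = \<phi> (Arg2pi z)" for z
  have F_cis: "F (cis x) = \<phi> x" if "x \<in> {0..2 * pi}" for x
  proof (cases "x = 2 * pi")
    case True
    have "Arg2pi 1 = 0" by (simp add: Arg2pi_eq_0)
    then show ?thesis using True per by (simp add: F_def)
  next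
    case False
    then have "Arg2pi (cis x) = x"
      using that by (intro Arg2pi_unique[of 1]) (auto simp: cis_conv_exp)
    then show ?thesis by (simp add: F_def)
  qed
  have sphere: "sphere 0 1 = cis ` {0..2 * pi}"
  proof
    show "sphere 0 1 \<subseteq> cis ` {0..2 * pi}"
    proof
      fix z :: complex assume "z \<in> sphere 0 1"
      then have "cis (Arg2pi z) = z"
        using Arg2pi_eq[of z, symmetric] by (simp add: cis_conv_exp)
      then show "z \<in> cis ` {0..2 * pi}"
        using Arg2pi_ge_0[of z] Arg2pi_lt_2pi[of z] by (intro image_eqI[of _ cis "Arg2pi z"]) auto
    qed
  qed auto
  \<comment> \<open>\<open>Arg2pi\<close> jumps at 1, so continuity is checked on closed preimages:
    the preimage of B under F is the image under \<open>cis\<close> of a compact subset of {0..2 *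
    pi}. Periodicity enters through \<open>F_cis\<close>.\<close>
  have "continuous_on (sphere 0 1) F"
    unfolding continuous_on_closed_vimage[OF closed_sphere]
  proof (intro allI impI)
    fix B :: "complex set" assume "closed B"
    then have "closed (\<phi> -` B \<inter> {0..2 * pi})"
      using cont continuous_on_closed_vimage[of "{0..2 * pi}" \<phi>] by simp
    then have "compact (\<phi> -` B \<inter> {0..2 * pi})"
      by (metis compact_Icc compact_Int_closed inf_commute inf_left_idem)
    then have "compact (cis ` (\<phi> -` B \<inter> {0..2 * pi}))"
      by (intro compact_continuous_image continuous_intros)
    moreover have "F -` B \<inter> sphere 0 1 = cis ` (\<phi> -` B \<inter> {0..2 * pi})"
      unfolding sphere using F_cis by auto
    ultimately show "closed (F -` B \<inter> sphere 0 1)" by (simp add: compact_imp_closed)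
  qed
  then obtain q where q: "polynomial_function q" "\<And>z. z \<in> sphere 0 1 \<Longrightarrow> cmod (F z - q z) < e"
    using Stone_Weierstrass_polynomial_function[OF compact_sphere _ \<open>e > 0\<close>, of 0 1 F] by auto
  show thesis
  proof
    show "trig_poly (\<lambda>x. q (cis x))" by (rule trig_poly_polynomial[OF q(1)])
    show "cmod (\<phi> x - q (cis x)) < e" if "x \<in> {0..2 * pi}" for x
      using q(2)[of "cis x"] F_cis[OF that] by simp
  qed
qed

section \<open>From vanishing Fourier coefficients to a vanishing function\<close>

lemma integrable_mult_bounded:
  fixes f g :: "'a \<Rightarrow> complex"
  assumes f: "integrable M f" and g: "g \<in> borel_measurable M" and B: "\<And>x. x \<in> space M \<Longrightarrow> cmod (g x) \<le> B"
  shows "integrable M (\<lambda>x. f x * g x)"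
proof (rule Bochner_Integration.integrable_bound[where f = "\<lambda>x. of_real B * f x"])
  show "AE x in M. cmod (f x * g x) \<le> cmod (of_real B * f x)"
  proof (rule AE_I2)
    fix x assume "x \<in> space M"
    then have "cmod (g x) \<le> \<bar>B\<bar>" using B by fastforce
    then show "cmod (f x * g x) \<le> cmod (of_real B * f x)"
      using mult_right_mono[of "cmod (g x)" "\<bar>B\<bar>" "cmod (f x)"] by (simp add: norm_mult mult.commute)
  qed
qed (use assms in auto)

lemma integrable_mult_continuous:
  fixes f g :: "real \<Rightarrow> complex"
  assumes f: "integrable (lebesgue_on {a..b}) f" and g: "continuous_on {a..b} g"
  shows "integrable (lebesgue_on {a..b}) (\<lambda>x. f x * g x)"
proof -
  have "compact (g ` {a..b})" using g by (intro compact_continuous_image) auto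
  then obtain B where "\<And>x. x \<in> {a..b} \<Longrightarrow> cmod (g x) \<le> B"
    by (metis bounded_iff compact_imp_bounded imageI)
  moreover have "g \<in> borel_measurable (lebesgue_on {a..b})"
    using g by (intro continuous_imp_measurable_on_sets_lebesgue) auto
  ultimately show ?thesis using f by (intro integrable_mult_bounded) auto
qed

lemma integral_mult_continuous_eq_0:
  fixes g \<phi> :: "real \<Rightarrow> complex"
  assumes g: "integrable (lebesgue_on {0..2 * pi}) g"
    and zero: "\<And>k. (LINT x|lebesgue_on {0..2 * pi}. g x * cis (of_int k * x)) = 0"
    and cont: "continuous_on {0..2 * pi} \<phi>" and per: "\<phi> (2 * pi) = \<phi> 0"
  shows "(LINT x|lebesgue_on {0..2 * pi}. g x * \<phi> x) = 0"
proof -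
  let ?M = "lebesgue_on {0..2 * pi}"
  have poly: "(LINT x|?M. g x * p x) = 0" if "trig_poly p" for p
    using that
  proof induction
    case (monomial c k)
    have "(LINT x|?M. g x * (c * cis (of_int k * x))) = (LINT x|?M. c * (g x * cis (of_int k * x)))"
      by (simp add: mult.left_commute)
    then show ?case using zero by simp
  next
    case (add p q)
    then have "(LINT x|?M. g x * p x + g x * q x) = 0"
      using g by (subst Bochner_Integration.integral_add) (auto intro!: integrable_mult_continuous trig_poly_continuous)
    then show ?case by (simp add: distrib_left)
  qed
  have bound: "cmod (LINT x|?M. g x * \<phi> x) \<le> e * (LINT x|?M. cmod (g x))" if "e > 0" for e
  proof -
    obtain p where p: "trig_poly p" "\<And>x. x \<in> {0..2 * pi} \<Longrightarrow> cmod (\<phi> x - p x) < e"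
      using trig_poly_approximation[OF cont per \<open>e > 0\<close>] by blast
    have i: "integrable ?M (\<lambda>x. g x * \<phi> x)" "integrable ?M (\<lambda>x. g x * p x)"
      using g cont p by (auto intro!: integrable_mult_continuous trig_poly_continuous)
    have "(LINT x|?M. g x * \<phi> x) = (LINT x|?M. g x * \<phi> x - g x * p x)"
      using i poly[OF p(1)] by simp
    also have "cmod \<dots> \<le> (LINT x|?M. cmod (g x * \<phi> x - g x * p x))" by (rule integral_norm_bound)
    also have "\<dots> \<le> (LINT x|?M. e * cmod (g x))"
    proof (rule integral_mono)
      fix x assume "x \<in> space ?M"
      then have "cmod (\<phi> x - p x) \<le> e" using p(2)[of x] by simp
      then show "cmod (g x * \<phi> x - g x * p x) \<le> e * cmod (g x)"
        using mult_right_mono[of "cmod (\<phi> x - p x)" e "cmod (g x)"]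
        by (simp add: right_diff_distrib[symmetric] norm_mult mult.commute[of "cmod (g x)"])
    qed (use i g in auto)
    finally show ?thesis by simp
  qed
  define G where "G = (LINT x|?M. cmod (g x))"
  have G: "0 \<le> G" unfolding G_def by (intro Bochner_Integration.integral_nonneg) auto
  have "cmod (LINT x|?M. g x * \<phi> x) \<le> 0"
  proof (rule field_le_epsilon)
    fix e :: real assume e: "e > 0"
    \<comment> \<open>The denominator G + 1 stays positive when G = 0.\<close>
    have "cmod (LINT x|?M. g x * \<phi> x) \<le> e / (G + 1) * G"
      by (rule bound[folded G_def]) (use e G in simp)
    also have "\<dots> \<le> e * 1"
      unfolding times_divide_eq_left[symmetric] times_divide_eq_right[symmetric] divide_inverse mult.assoc
      using e G by (intro mult_left_mono) (auto simp: field_simps)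
    finally show "cmod (LINT x|?M. g x * \<phi> x) \<le> 0 + e" by simp
  qed
  then show ?thesis by simp
qed

text \<open>Tests \<open>g\<close> against continuous functions \<open>\<psi> n\<close> bounded by 1 that converge to \<open>cnj g / \<bar>g\<bar>\<close> almost
  everywhere; the factor vanishing at both end points makes them periodic.\<close>
lemma fourier_uniqueness:
  fixes g :: "real \<Rightarrow> complex"
  assumes g: "integrable (lebesgue_on {0..2 * pi}) g"
    and zero: "\<And>k. (LINT x|lebesgue_on {0..2 * pi}. g x * cis (of_int k * x)) = 0"
  shows "AE x in lebesgue_on {0..2 * pi}. g x = 0"
proof -
  let ?M = "lebesgue_on {0..2 * pi}"
  \<comment> \<open>Where g x = 0, division by zero gives h x = 0; so |h x| <= 1 and g x * h x = |g
    x| hold everywhere.\<close>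
  define h where "h x = cnj (g x) / of_real (cmod (g x))" for x
  have [measurable]: "g \<in> borel_measurable ?M" using g by simp
  have "(\<lambda>x. cnj (g x)) \<in> borel_measurable ?M"
    using g by (intro borel_measurable_integrable) (simp add: integrable_cnj)
  moreover have "(\<lambda>x. complex_of_real (cmod (g x))) \<in> borel_measurable ?M"
    using g by (intro borel_measurable_integrable) simp
  ultimately have [measurable]: "h \<in> borel_measurable ?M" unfolding h_def by measurable
  \<comment> \<open>Provides continuous functions \<open>q n\<close> that converge to h almost
    everywhere.\<close>
  then have "h measurable_on {0..2 * pi}" by (simp add: measurable_on_iff_borel_measurable)
  then obtain N q where N: "negligible N" and q: "\<And>n. continuous_on UNIV (q n)"
    and lim: "\<And>x. x \<notin> N \<Longrightarrow> (\<lambda>n. q n x) \<longlonglongrightarrow> (if x \<in> {0..2 * pi} then h x else 0)"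
    unfolding measurable_on_def by blast
  \<comment> \<open>The first factor vanishes at 0 and 2 pi and is eventually 1 at each point in
    between. Dividing by the maximum caps the modulus at 1 and does not change the limit, because
    |h| <= 1.\<close>
  define \<psi> where "\<psi> n x = complex_of_real (min 1 (real n * (x * (2 * pi - x)))) * (q n x / of_real (max 1 (cmod (q n x))))" for n x
  have \<psi>_cont: "continuous_on S (\<psi> n)" for n S
    unfolding \<psi>_def using q by (intro continuous_intros) (auto intro: continuous_on_subset)
  have \<psi>_le: "cmod (\<psi> n x) \<le> 1" if "x \<in> {0..2 * pi}" for n x
  proof -
    have "0 \<le> x * (2 * pi - x)" using that by (intro mult_nonneg_nonneg) auto
    then have "0 \<le> min 1 (real n * (x * (2 * pi - x)))" by simp
    then have "\<bar>min 1 (real n * (x * (2 * pi - x)))\<bar> \<le> 1" by linarith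
    moreover have "cmod (q n x) / \<bar>max 1 (cmod (q n x))\<bar> \<le> 1" by (simp add: divide_le_eq)
    ultimately have "\<bar>min 1 (real n * (x * (2 * pi - x)))\<bar> * (cmod (q n x) / \<bar>max 1 (cmod (q n x))\<bar>) \<le> 1 * 1"
      by (intro mult_mono) auto
    then show ?thesis unfolding \<psi>_def norm_mult norm_divide norm_of_real by simp
  qed
  have "negligible (N \<union> {0, 2 * pi})" using N by (simp add: negligible_Un)
  then have "AE x in lebesgue. x \<notin> N \<union> {0, 2 * pi}"
    by (intro AE_not_in) (simp add: negligible_iff_null_sets)
  then have ae: "AE x in ?M. x \<notin> N \<union> {0, 2 * pi}"
    by (subst AE_restrict_space_iff) auto
  have "(\<lambda>n. LINT x|?M. g x * \<psi> n x) \<longlonglongrightarrow> (LINT x|?M. of_real (cmod (g x)))"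
  proof (rule integral_dominated_convergence[where w = "\<lambda>x. cmod (g x)"])
    show "(\<lambda>x. g x * \<psi> n x) \<in> borel_measurable ?M" for n
      using \<psi>_cont g by (intro borel_measurable_integrable integrable_mult_continuous)
    show "AE x in ?M. cmod (g x * \<psi> n x) \<le> cmod (g x)" for n
      using \<psi>_le by (intro AE_I2) (auto simp: norm_mult intro: mult_left_le)
    show "AE x in ?M. (\<lambda>n. g x * \<psi> n x) \<longlonglongrightarrow> of_real (cmod (g x))"
      using ae AE_space[of ?M]
    proof eventually_elim
      case (elim x)
      then have x: "0 < x * (2 * pi - x)" and q_lim: "(\<lambda>n. q n x) \<longlonglongrightarrow> h x"
        using lim[of x] by (auto intro!: mult_pos_pos)
      have "(\<lambda>n. complex_of_real (min 1 (real n * (x * (2 * pi - x))))) \<longlonglongrightarrow> 1"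
      proof (rule tendsto_eventually)
        obtain m :: nat where m: "1 < real m * (x * (2 * pi - x))"
          using reals_Archimedean3[OF x] by blast
        have "1 \<le> real n * (x * (2 * pi - x))" if "m \<le> n" for n
        proof -
          have "real m * (x * (2 * pi - x)) \<le> real n * (x * (2 * pi - x))"
            using that x by (intro mult_right_mono) auto
          with m show ?thesis by linarith
        qed
        then show "\<forall>\<^sub>F n in sequentially. complex_of_real (min 1 (real n * (x * (2 * pi - x)))) = 1"
          by (auto simp: eventually_sequentially min_absorb1 intro!: exI[of _ m])
      qed
      moreover have "(\<lambda>n. q n x / of_real (max 1 (cmod (q n x)))) \<longlonglongrightarrow> h x / of_real (max 1 (cmod (h x)))"
        by (intro tendsto_intros q_lim) auto
      ultimately have "(\<lambda>n. g x * \<psi> n x) \<longlonglongrightarrow> g x * (1 * (h x / of_real (max 1 (cmod (h x)))))"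
        unfolding \<psi>_def by (intro tendsto_mult tendsto_const)
      moreover have "cmod (h x) \<le> 1" by (simp add: h_def norm_divide)
      moreover have "g x * h x = of_real (cmod (g x))"
        by (cases "g x = 0") (simp_all add: h_def complex_norm_square[symmetric] power2_eq_square)
      ultimately show ?case by (simp add: max_absorb1)
    qed
  qed (use g in auto)
  moreover have "(LINT x|?M. g x * \<psi> n x) = 0" for n
    by (rule integral_mult_continuous_eq_0[OF g zero \<psi>_cont]) (simp add: \<psi>_def)
  ultimately have "(LINT x|?M. complex_of_real (cmod (g x))) = 0"
    by (simp add: LIMSEQ_const_iff)
  then have "(LINT x|?M. cmod (g x)) = 0"
    by simp
  then have "AE x in ?M. cmod (g x) = 0"
    using g integral_nonneg_eq_0_iff_AE[of ?M "\<lambda>x. cmod (g x)"] by simp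
  then show ?thesis by simp
qed

section \<open>Observability from two lines\<close>

definition fibre_sum :: "('a \<Rightarrow> int) \<Rightarrow> 'a set \<Rightarrow> ('a \<Rightarrow> complex) \<Rightarrow> int \<Rightarrow> complex" where
  "fibre_sum \<nu> K d n = (\<Sum>k\<in>{k\<in>K. \<nu> k = n}. d k)"

lemma trig_sum_fibre_sum:
  assumes "finite K"
  shows "(\<Sum>k\<in>K. d k * cis (of_int (\<nu> k) * t)) = trig_sum (\<nu> ` K) (fibre_sum \<nu> K d) t"
proof -
  have "(\<Sum>k\<in>K. d k * cis (of_int (\<nu> k) * t)) =
      (\<Sum>n\<in>\<nu> ` K. \<Sum>k\<in>{k\<in>K. \<nu> k = n}. d k * cis (of_int (\<nu> k) * t))"
    using assms by (rule sum.image_gen)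
  also have "\<dots> = (\<Sum>n\<in>\<nu> ` K. \<Sum>k\<in>{k\<in>K. \<nu> k = n}. d k * cis (of_int n * t))"
    by (intro sum.cong) auto
  finally show ?thesis by (simp add: trig_sum_def fibre_sum_def sum_distrib_right)
qed

lemma norm_sum_square_le:
  fixes d :: "'a \<Rightarrow> complex"
  shows "(cmod (sum d A))\<^sup>2 \<le> real (card A) * (\<Sum>k\<in>A. (cmod (d k))\<^sup>2)"
proof -
  have "(cmod (sum d A))\<^sup>2 \<le> (\<Sum>k\<in>A. 1 * cmod (d k))\<^sup>2"
    by (intro power_mono) (simp_all add: norm_sum)
  also have "\<dots> \<le> (\<Sum>k\<in>A. 1\<^sup>2) * (\<Sum>k\<in>A. (cmod (d k))\<^sup>2)"
    by (rule Cauchy_Schwarz_ineq_sum)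
  finally show ?thesis by simp
qed

lemma sum_fibre_sum_square_le:
  assumes "finite K" and B: "\<And>k. k \<in> K \<Longrightarrow> card {l\<in>K. \<nu> l = \<nu> k} \<le> B"
  shows "(\<Sum>n\<in>\<nu> ` K. (cmod (fibre_sum \<nu> K d n))\<^sup>2) \<le> real B * (\<Sum>k\<in>K. (cmod (d k))\<^sup>2)"
proof -
  have "(\<Sum>n\<in>\<nu> ` K. (cmod (fibre_sum \<nu> K d n))\<^sup>2) \<le> (\<Sum>n\<in>\<nu> ` K. real B * (\<Sum>k\<in>{k\<in>K. \<nu> k = n}. (cmod (d k))\<^sup>2))"
  proof (rule sum_mono)
    fix n assume "n \<in> \<nu> ` K"
    then have "real (card {k\<in>K. \<nu> k = n}) \<le> real B" using B by auto
    then show "(cmod (fibre_sum \<nu> K d n))\<^sup>2 \<le> real B * (\<Sum>k\<in>{k\<in>K. \<nu> k = n}. (cmod (d k))\<^sup>2)"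
      unfolding fibre_sum_def
      by (intro order_trans[OF norm_sum_square_le] mult_right_mono sum_nonneg) auto
  qed
  also have "\<dots> = real B * (\<Sum>k\<in>K. (cmod (d k))\<^sup>2)"
    by (simp only: sum_distrib_left[symmetric] sum.image_gen[OF assms(1), of "\<lambda>k. (cmod (d k))\<^sup>2" \<nu>])
  finally show ?thesis .
qed

text \<open>R contains every index that collides with another one, so fibres have at most card R + 1
  elements. Hence the energy of a difference of partial sums is at most a constant times the
  increment of the sums of |d k|^2, which converge, being monotone and bounded;
  \<open>locally_L2_complete\<close> then applies.\<close>

lemma exponential_series_L2:
  fixes \<nu> :: "int \<Rightarrow> int"
  assumes R: "finite R" "\<And>k. {l. \<nu> l = \<nu> k} \<subseteq> insert k R"
    and bounded: "\<And>N. (\<Sum>k=-int N..int N. (cmod (d k))\<^sup>2) \<le> Q"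
  obtains f where "\<And>a b. f \<in> L2_on {a..b}"
    and "\<And>a b. (\<lambda>N. LINT t|lebesgue_on {a..b}.
        (cmod ((\<Sum>k=-int N..int N. d k * cis (of_int (\<nu> k) * t)) - f t))\<^sup>2) \<longlonglongrightarrow> 0"
proof -
  define s where "s N = (\<Sum>k=-int N..int N. (cmod (d k))\<^sup>2)" for N
  define g where "g N t = (\<Sum>k=-int N..int N. d k * cis (of_int (\<nu> k) * t))" for N t
  have s_mono: "s M \<le> s N" if "M \<le> N" for M N
    unfolding s_def using that by (intro sum_mono2) auto
  have cont: "continuous_on UNIV (g N)" for N
    unfolding g_def by (intro continuous_intros)
  have conv: "convergent s"
    using bounded s_mono incseq_convergent[of s Q] unfolding s_def[symmetric]
    by (metis convergent_def incseq_def)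
  have bound: "\<exists>K\<ge>0. \<forall>M N. integral {a..b} (\<lambda>t. (cmod (g N t - g M t))\<^sup>2) \<le> K * \<bar>s N - s M\<bar>" for a b
  proof -
    obtain K where K: "0 \<le> K" "\<And>F a'. finite F \<Longrightarrow>
      integral {a..b} (\<lambda>t. (cmod (trig_sum F a' t))\<^sup>2) \<le> K * (\<Sum>n\<in>F. (cmod (a' n))\<^sup>2)"
      using trig_sum_upper_bound by blast
    define B where "B = Suc (card R)"
    have le: "integral {a..b} (\<lambda>t. (cmod (g N t - g M t))\<^sup>2) \<le> K * real B * \<bar>s N - s M\<bar>" if "M \<le> N" for M N
    proof -
      define D where "D = {-int N..int N} - {-int M..int M}"
      have sub: "{-int M..int M} \<subseteq> {-int N..int N}" using that by auto
      have fin: "finite D" by (simp add: D_def)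
      have diff: "g N t - g M t = trig_sum (\<nu> ` D) (fibre_sum \<nu> D d) t" for t
        unfolding trig_sum_fibre_sum[OF fin, symmetric]
        unfolding g_def D_def using sub by (intro sum_diff[symmetric]) auto
      have card: "card {l\<in>D. \<nu> l = \<nu> k} \<le> B" for k
      proof -
        have "card {l\<in>D. \<nu> l = \<nu> k} \<le> card (insert k R)"
          using R by (intro card_mono) auto
        also have "\<dots> \<le> B" using R(1) by (simp add: B_def card_insert_if)
        finally show ?thesis .
      qed
      have "integral {a..b} (\<lambda>t. (cmod (g N t - g M t))\<^sup>2) \<le> K * (\<Sum>n\<in>\<nu> ` D. (cmod (fibre_sum \<nu> D d n))\<^sup>2)"
        unfolding diff using fin by (intro K(2)) auto
      also have "\<dots> \<le> K * (real B * (\<Sum>k\<in>D. (cmod (d k))\<^sup>2))"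
        by (intro mult_left_mono sum_fibre_sum_square_le fin card K(1))
      also have "(\<Sum>k\<in>D. (cmod (d k))\<^sup>2) = s N - s M"
        unfolding D_def s_def using sub by (intro sum_diff) auto
      finally show ?thesis using s_mono[OF that] by (simp add: mult.assoc)
    qed
    have "integral {a..b} (\<lambda>t. (cmod (g N t - g M t))\<^sup>2) \<le> K * real B * \<bar>s N - s M\<bar>" for M N
    proof (cases "M \<le> N")
      case False
      then have "integral {a..b} (\<lambda>t. (cmod (g M t - g N t))\<^sup>2) \<le> K * real B * \<bar>s M - s N\<bar>"
        by (intro le) auto
      then show ?thesis by (simp add: norm_minus_commute abs_minus_commute)
    qed (rule le)
    moreover have "0 \<le> K * real B" using K by simp
    ultimately show ?thesis by blast
  qed
  obtain f where f: "\<And>a b. f \<in> L2_on {a..b}"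
    "\<And>a b. (\<lambda>N. LINT t|lebesgue_on {a..b}. (cmod (g N t - f t))\<^sup>2) \<longlonglongrightarrow> 0"
    using locally_L2_complete[OF cont conv bound] by blast
  show thesis
    using f unfolding g_def by (rule that)
qed

section \<open>Fourier coefficients and the L2 norm of a function on the circle\<close>

lemma integrable_square_trig_sum:
  "integrable (lebesgue_on {a..b}) (\<lambda>t. (cmod (trig_sum F c t))\<^sup>2)"
  by (intro continuous_imp_integrable_real continuous_intros)

lemma lebesgue_integral_square_trig_sum:
  "(LINT t|lebesgue_on {a..b}. (cmod (trig_sum F c t))\<^sup>2) = integral {a..b} (\<lambda>t. (cmod (trig_sum F c t))\<^sup>2)"
  by (intro lebesgue_integral_eq_integral integrable_square_trig_sum) auto

lemma L2_on_integrable: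
  assumes "f \<in> L2_on {a..b}"
  shows "integrable (lebesgue_on {a..b}) f"
proof (rule Bochner_Integration.integrable_bound)
  show "integrable (lebesgue_on {a..b}) (\<lambda>x. 1 + (cmod (f x))\<^sup>2)"
    using assms by (auto simp: L2_on_def)
  have "cmod z \<le> 1 + (cmod z)\<^sup>2" for z
    using sum_squares_bound[of 1 "cmod z"] norm_ge_zero[of z] by (simp only: one_power2 mult_1_right)
  then show "AE x in lebesgue_on {a..b}. cmod (f x) \<le> norm (1 + (cmod (f x))\<^sup>2)"
    by (auto simp: abs_of_nonneg)
qed (use assms in \<open>auto simp: L2_on_def\<close>)

text \<open>The exponential is not conjugated, so it picks out the index \<open>- k\<close>, in
  agreement with \<open>fourier_coeff_integral\<close>.\<close>

lemma trig_sum_coefficient: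
  fixes a :: "int \<Rightarrow> complex"
  assumes "finite F"
  shows "(LINT x|lebesgue_on {0..2 * pi}. trig_sum F a x * cis (of_int k * x)) =
    (if - k \<in> F then 2 * pi * a (- k) else 0)"
proof -
  have "0 + 2 * pi * real 1 = 2 * pi" by simp
  note orth = cis_orthogonality[of _ 1 0, unfolded this]
  have "(LINT x|lebesgue_on {0..2 * pi}. trig_sum F a x * cis (of_int k * x)) =
      integral {0..2 * pi} (\<lambda>x. trig_sum F a x * cis (of_int k * x))"
    by (intro lebesgue_integral_eq_integral continuous_imp_integrable_real continuous_intros) auto
  also have "\<dots> = integral {0..2 * pi} (\<lambda>x. \<Sum>n\<in>F. a n * cis (of_int (n + k) * x))"
    by (rule integral_cong) (simp add: trig_sum_def sum_distrib_right cis_mult mult.assoc distrib_right)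
  also have "\<dots> = (\<Sum>n\<in>F. a n * (if n + k = 0 then 2 * pi * real 1 else 0))"
    by (intro integral_unique has_integral_sum has_integral_mult_right orth assms)
  also have "\<dots> = (\<Sum>n\<in>F. if - k = n then 2 * pi * a n else 0)"
    by (intro sum.cong refl) (auto simp: eq_neg_iff_add_eq_0)
  also have "\<dots> = (if - k \<in> F then 2 * pi * a (- k) else 0)"
    using assms by (simp add: sum.delta')
  finally show ?thesis .
qed

lemma fourier_coeff_integral:
  "(LINT x|lebesgue_on {0..2 * pi}. u x * cis (of_int k * x)) = 2 * pi * fourier_coeff u (- k)"
  by (simp add: fourier_coeff_def)

lemma Bessel_inequality:
  assumes u: "u \<in> L2_on {0..2 * pi}" and F: "finite F"
  shows "2 * pi * (\<Sum>k\<in>F. (cmod (fourier_coeff u k))\<^sup>2) \<le> (LINT x|lebesgue_on {0..2 * pi}. (cmod (u x))\<^sup>2)"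
proof -
  let ?M = "lebesgue_on {0..2 * pi}"
  define S where "S = trig_sum F (fourier_coeff u)"
  define Q where "Q = (\<Sum>k\<in>F. (cmod (fourier_coeff u k))\<^sup>2)"
  have S_cont: "continuous_on X S" for X unfolding S_def by (intro continuous_intros continuous_on_id)
  have u_int: "integrable ?M u" using u by (rule L2_on_integrable)
  have u2: "integrable ?M (\<lambda>x. (cmod (u x))\<^sup>2)" using u by (simp add: L2_on_def)
  have S2: "integrable ?M (\<lambda>x. (cmod (S x))\<^sup>2)" unfolding S_def by (rule integrable_square_trig_sum)
  have S2_eq: "(LINT x|?M. (cmod (S x))\<^sup>2) = 2 * pi * Q"
    using trig_sum_Parseval[OF F, of 0 1] by (simp add: S_def Q_def lebesgue_integral_square_trig_sum)
  have cross_int: "integrable ?M (\<lambda>x. u x * cnj (S x))"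
    by (intro integrable_mult_continuous u_int continuous_on_cnj S_cont)
  define r where "r x = Re (u x * cnj (S x))" for x
  have r_int: "integrable ?M r" unfolding r_def by (rule integrable_Re[OF cross_int])
  have "(LINT x|?M. u x * cnj (S x)) = (LINT x|?M. (\<Sum>k\<in>F. cnj (fourier_coeff u k) * (u x * cis (of_int (- k) * x))))"
    by (simp add: S_def trig_sum_def cis_cnj sum_distrib_left mult.left_commute)
  also have "\<dots> = (\<Sum>k\<in>F. cnj (fourier_coeff u k) * (LINT x|?M. u x * cis (of_int (- k) * x)))"
    by (subst Bochner_Integration.integral_sum)
      (auto simp del: of_int_minus intro!: integrable_mult_right integrable_mult_continuous[OF u_int] continuous_intros)
  also have "\<dots> = (\<Sum>k\<in>F. complex_of_real (2 * pi * (cmod (fourier_coeff u k))\<^sup>2))"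
    unfolding fourier_coeff_integral of_real_mult complex_norm_square by (simp add: mult_ac)
  also have "\<dots> = complex_of_real (2 * pi * Q)" by (simp add: Q_def sum_distrib_left)
  finally have "(LINT x|?M. u x * cnj (S x)) = complex_of_real (2 * pi * Q)" .
  then have cross: "(LINT x|?M. r x) = 2 * pi * Q"
    unfolding r_def by (simp only: integral_Re[OF cross_int] Re_complex_of_real)
  have "0 \<le> (LINT x|?M. (cmod (u x - S x))\<^sup>2)" by simp
  also have "(\<lambda>x. (cmod (u x - S x))\<^sup>2) = (\<lambda>x. (cmod (u x))\<^sup>2 - 2 * r x + (cmod (S x))\<^sup>2)"
    by (rule ext, simp only: r_def cmod_power2) (simp add: power2_eq_square algebra_simps)
  also have "(LINT x|?M. (cmod (u x))\<^sup>2 - 2 * r x + (cmod (S x))\<^sup>2) =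
      (LINT x|?M. (cmod (u x))\<^sup>2) - 2 * (2 * pi * Q) + 2 * pi * Q"
    using u2 S2 S2_eq cross r_int by simp
  finally show ?thesis by (simp add: Q_def)
qed

text \<open>Stands in for Parseval's identity: the partial sums converge in L2 to some f, and u - f
  has vanishing Fourier coefficients, so u = f almost everywhere. The bound \<open>e N\<close> may
  contain an error that dies out with N. The factor is 4 pi rather than 2 pi because f is compared
  with its partial sums through |x + y|^2 <= 2 |x|^2 + 2 |y|^2.\<close>

lemma fourier_coeff_bound_imp_L2_bound:
  assumes u: "u \<in> L2_on {0..2 * pi}"
    and le: "\<And>N. (\<Sum>k=-int N..int N. (cmod (fourier_coeff u k))\<^sup>2) \<le> e N" and lim: "e \<longlonglongrightarrow> L"
  shows "(LINT x|lebesgue_on {0..2 * pi}. (cmod (u x))\<^sup>2) \<le> 4 * pi * L"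
proof -
  let ?M = "lebesgue_on {0..2 * pi}"
  define S where "S N = trig_sum {-int N..int N} (fourier_coeff u)" for N
  have S_cont: "continuous_on X (S N)" for X N unfolding S_def by (intro continuous_intros continuous_on_id)
  have bounded: "(\<Sum>k=-int N..int N. (cmod (fourier_coeff u k))\<^sup>2) \<le> (LINT x|?M. (cmod (u x))\<^sup>2) / (2 * pi)" for N
    using Bessel_inequality[OF u, of "{-int N..int N}"] by (simp add: field_simps)
  obtain f where f: "\<And>a b. f \<in> L2_on {a..b}"
    and f_lim0: "\<And>a b. (\<lambda>N. LINT t|lebesgue_on {a..b}.
        (cmod ((\<Sum>k=-int N..int N. fourier_coeff u k * cis (of_int k * t)) - f t))\<^sup>2) \<longlonglongrightarrow> 0"
    \<comment> \<open>The frequencies are the indices themselves, so the exceptional set is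
      empty.\<close>
    using exponential_series_L2[of "{}" "\<lambda>k. k" "fourier_coeff u", OF _ _ bounded] by auto
  define \<epsilon> where "\<epsilon> N = (LINT t|?M. (cmod (S N t - f t))\<^sup>2)" for N
  have f_lim: "\<epsilon> \<longlonglongrightarrow> 0"
    using f_lim0[of 0 "2 * pi"] unfolding \<epsilon>_def S_def trig_sum_def .
  have f_int: "integrable ?M f" and u_int: "integrable ?M u"
    using f u by (auto intro: L2_on_integrable)
  have f2: "integrable ?M (\<lambda>t. (cmod (f t))\<^sup>2)" using f by (simp add: L2_on_def)
  have S_int: "integrable ?M (S N)" for N
    by (intro continuous_imp_integrable_real S_cont)
  have S2: "integrable ?M (\<lambda>t. (cmod (S N t))\<^sup>2)" for N
    unfolding S_def by (rule integrable_square_trig_sum)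
  have diff2: "integrable ?M (\<lambda>t. (cmod (S N t - f t))\<^sup>2)" for N
    using S2 f2 S_int f_int by (intro integrable_cmod_square_diff) auto
  have "(LINT x|?M. (u x - f x) * cis (of_int k * x)) = 0" for k
  proof -
    define X where "X = cmod (LINT x|?M. (u x - f x) * cis (of_int k * x))"
    \<comment> \<open>Once N >= |k|, \<open>S N\<close> and u share the coefficient in question.
      Integrating |z| <= \<eta> / 2 + |z|^2 / (2 \<eta>) over length 2 pi gives the bound; N goes to
      infinity first, \<eta> to 0 afterwards.\<close>
    have X_le: "X \<le> pi * \<eta> + \<epsilon> N / (2 * \<eta>)" if \<eta>: "0 < \<eta>" and N: "nat \<bar>k\<bar> \<le> N" for \<eta> N
    proof -
      have i: "integrable ?M (\<lambda>x. v x * cis (of_int k * x))" if "integrable ?M v" for v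
        using that by (intro integrable_mult_continuous continuous_intros)
      have "(LINT x|?M. u x * cis (of_int k * x)) = (LINT x|?M. S N x * cis (of_int k * x))"
        unfolding S_def using N by (subst trig_sum_coefficient) (auto simp: fourier_coeff_integral)
      then have "(LINT x|?M. (u x - f x) * cis (of_int k * x)) = (LINT x|?M. (S N x - f x) * cis (of_int k * x))"
        using i[OF u_int] i[OF f_int] i[OF S_int] by (simp add: left_diff_distrib)
      then have "X = cmod (LINT x|?M. (S N x - f x) * cis (of_int k * x))" by (simp add: X_def)
      also have "\<dots> \<le> (LINT x|?M. cmod ((S N x - f x) * cis (of_int k * x)))" by (rule integral_norm_bound)
      also have "\<dots> \<le> (LINT x|?M. \<eta> / 2 + (cmod (S N x - f x))\<^sup>2 / (2 * \<eta>))"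
      proof (rule integral_mono)
        fix x
        have "2 * cmod (S N x - f x) * \<eta> \<le> (cmod (S N x - f x))\<^sup>2 + \<eta>\<^sup>2"
          by (rule sum_squares_bound)
        then have "cmod (S N x - f x) \<le> \<eta> / 2 + (cmod (S N x - f x))\<^sup>2 / (2 * \<eta>)"
          using \<eta> by (simp add: field_simps power2_eq_square)
        then show "cmod ((S N x - f x) * cis (of_int k * x)) \<le> \<eta> / 2 + (cmod (S N x - f x))\<^sup>2 / (2 * \<eta>)"
          unfolding norm_mult norm_cis by simp
      qed (use diff2[of N] in \<open>auto intro!: integrable_norm i S_int f_int Bochner_Integration.integrable_diff\<close>)
      also have "\<dots> = pi * \<eta> + \<epsilon> N / (2 * \<eta>)"
        using diff2[of N] by (simp add: \<epsilon>_def measure_restrict_space)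
      finally show ?thesis .
    qed
    have X_le': "X \<le> pi * \<eta>" if "0 < \<eta>" for \<eta>
    proof (rule LIMSEQ_le_const)
      have "(\<lambda>N. pi * \<eta> + \<epsilon> N / (2 * \<eta>)) \<longlonglongrightarrow> pi * \<eta> + 0 / (2 * \<eta>)"
        using that by (intro tendsto_intros f_lim) auto
      then show "(\<lambda>N. pi * \<eta> + \<epsilon> N / (2 * \<eta>)) \<longlonglongrightarrow> pi * \<eta>" by simp
    qed (use X_le[OF that] in blast)
    have "X \<le> 0"
    proof (rule field_le_epsilon)
      fix e :: real assume "0 < e"
      then show "X \<le> 0 + e" using X_le'[of "e / pi"] by simp
    qed
    then show ?thesis by (simp add: X_def)
  qed
  then have "AE x in ?M. u x - f x = 0"
    using u_int f_int by (intro fourier_uniqueness Bochner_Integration.integrable_diff)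
  then have "AE x in ?M. (cmod (u x))\<^sup>2 = (cmod (f x))\<^sup>2" by eventually_elim simp
  then have u_f: "(LINT x|?M. (cmod (u x))\<^sup>2) = (LINT x|?M. (cmod (f x))\<^sup>2)"
    using u_int f_int by (intro integral_cong_AE) (auto intro!: borel_measurable_power borel_measurable_norm)
  have "(LINT x|?M. (cmod (u x))\<^sup>2) \<le> 2 * \<epsilon> N + 4 * pi * e N" for N
  proof -
    have "(LINT x|?M. (cmod (f x))\<^sup>2) \<le> 2 * (LINT x|?M. (cmod (f x - S N x))\<^sup>2) + 2 * (LINT x|?M. (cmod (S N x))\<^sup>2)"
      using diff2[of N] S2 f_int by (intro integrable_cmod_square_le(2)) (auto simp: norm_minus_commute)
    also have "(LINT x|?M. (cmod (f x - S N x))\<^sup>2) = \<epsilon> N" by (simp add: \<epsilon>_def norm_minus_commute)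
    also have "(LINT x|?M. (cmod (S N x))\<^sup>2) = 2 * pi * (\<Sum>k=-int N..int N. (cmod (fourier_coeff u k))\<^sup>2)"
      using trig_sum_Parseval[of "{-int N..int N}" 0 1] by (simp add: S_def lebesgue_integral_square_trig_sum)
    also have "\<dots> \<le> 2 * pi * e N" by (intro mult_left_mono le) auto
    finally show ?thesis using u_f by simp
  qed
  moreover have "(\<lambda>N. 2 * \<epsilon> N + 4 * pi * e N) \<longlonglongrightarrow> 2 * 0 + 4 * pi * L"
    by (intro tendsto_intros f_lim lim)
  ultimately show ?thesis using LIMSEQ_le_const by fastforce
qed


section \<open>The linear KdV flow along a line\<close>

lemma kdv_partial_sum_on_line:
  "kdv_partial_sum u N (t0 + t) (x0 - of_int v * t) =
    (\<Sum>k=-int N..int N. fourier_coeff u k * cis (of_int k ^ 3 * t0 + of_int k * x0) * cis (of_int (freq v k) * t))"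
proof -
  have "cis (of_int k ^ 3 * (t0 + t)) * cis (of_int k * (x0 - of_int v * t)) =
      cis (of_int k ^ 3 * t0 + of_int k * x0) * cis (of_int (freq v k) * t)" for k
    by (simp add: cis_mult freq_def algebra_simps)
  then show ?thesis by (simp add: kdv_partial_sum_def mult.assoc)
qed

text \<open>Shows that the choice in \<open>kdv_on_line\<close> has a witness. Bessel's inequality
  bounds the coefficients, whose phases have modulus 1.\<close>

lemma kdv_on_line:
  assumes u: "u \<in> L2_on {0..2 * pi}"
  shows "kdv_on_line u t0 x0 v \<in> L2_on {a..b}"
    and "(\<lambda>N. LINT t|lebesgue_on {a..b}.
      (cmod (kdv_partial_sum u N (t0 + t) (x0 - of_int v * t) - kdv_on_line u t0 x0 v t))\<^sup>2) \<longlonglongrightarrow> 0"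
proof -
  let ?d = "\<lambda>k. fourier_coeff u k * cis (of_int k ^ 3 * t0 + of_int k * x0)"
  have "(\<Sum>k=-int N..int N. (cmod (?d k))\<^sup>2) \<le> (LINT x|lebesgue_on {0..2 * pi}. (cmod (u x))\<^sup>2) / (2 * pi)" for N
    using Bessel_inequality[OF u, of "{-int N..int N}"] by (simp add: norm_mult field_simps)
  then obtain f where "\<And>a b. f \<in> L2_on {a..b}"
    and "\<And>a b. (\<lambda>N. LINT t|lebesgue_on {a..b}.
        (cmod ((\<Sum>k=-int N..int N. ?d k * cis (of_int (freq v k) * t)) - f t))\<^sup>2) \<longlonglongrightarrow> 0"
    using exponential_series_L2[OF finite_resonant freq_fibre_subset, where d = ?d] by blast
  then have "\<exists>f. \<forall>a b. f \<in> L2_on {a..b} \<and>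
        (\<lambda>N. LINT t|lebesgue_on {a..b}.
               (cmod (kdv_partial_sum u N (t0 + t) (x0 - real_of_int v * t) - f t))\<^sup>2) \<longlonglongrightarrow> 0"
    unfolding kdv_partial_sum_on_line by blast
  from someI_ex[OF this, folded kdv_on_line_def]
  show "kdv_on_line u t0 x0 v \<in> L2_on {a..b}"
    and "(\<lambda>N. LINT t|lebesgue_on {a..b}.
      (cmod (kdv_partial_sum u N (t0 + t) (x0 - of_int v * t) - kdv_on_line u t0 x0 v t))\<^sup>2) \<longlonglongrightarrow> 0"
    by blast+
qed

text \<open>Write A and B for the two energies on the right. Off R the w-fibres are singletons, so B
  contains those coefficients directly. For k in R the other members of its v-fibre lie outside R by
  \<open>sep\<close>, number at most m, and have modulus at most sqrt (A + B); subtracting them from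
  the fibre sum gives |c k| <= (1 + m) sqrt (A + B). Summation over R yields the constant. In the
  application \<open>d1\<close> and \<open>d2\<close> are c with the phases of the two lines, so
  only moduli can be compared.\<close>

lemma sum_square_le_fibre_sums:
  assumes K: "finite K" and d: "\<And>k. cmod (d1 k) = cmod (c k)" "\<And>k. cmod (d2 k) = cmod (c k)"
    and sep: "\<And>k l. resonant w k \<Longrightarrow> resonant w l \<Longrightarrow> freq v k = freq v l \<Longrightarrow> k = l"
  shows "(\<Sum>k\<in>K. (cmod (c k))\<^sup>2) \<le>
    (1 + real (card {k. resonant w k}) * (1 + real (card {k. resonant v k}))\<^sup>2) *
    ((\<Sum>n\<in>freq v ` K. (cmod (fibre_sum (freq v) K d1 n))\<^sup>2) + (\<Sum>n\<in>freq w ` K. (cmod (fibre_sum (freq w) K d2 n))\<^sup>2))"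
proof -
  define R where "R = {k. resonant w k}"
  define m where "m = real (card {k. resonant v k})"
  define A where "A = (\<Sum>n\<in>freq v ` K. (cmod (fibre_sum (freq v) K d1 n))\<^sup>2)"
  define B where "B = (\<Sum>n\<in>freq w ` K. (cmod (fibre_sum (freq w) K d2 n))\<^sup>2)"
  have R: "finite R" unfolding R_def by (rule finite_resonant)
  have nonneg: "0 \<le> A" "0 \<le> B" by (simp_all add: A_def B_def sum_nonneg)
  have m: "0 \<le> m" by (simp add: m_def)
  have simple: "fibre_sum (freq w) K d2 (freq w k) = d2 k" if "k \<in> K - R" for k
  proof -
    have "{l\<in>K. freq w l = freq w k} = {k}" using that by (auto simp: R_def resonant_def)
    then show ?thesis by (simp add: fibre_sum_def)
  qed
  have nonres: "(\<Sum>k\<in>K - R. (cmod (c k))\<^sup>2) \<le> B"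
  proof -
    have inj: "inj_on (freq w) (K - R)" by (auto simp: inj_on_def R_def resonant_def)
    have "(\<Sum>k\<in>K - R. (cmod (c k))\<^sup>2) = (\<Sum>k\<in>K - R. (cmod (fibre_sum (freq w) K d2 (freq w k)))\<^sup>2)"
      by (intro sum.cong refl) (simp add: simple d)
    also have "\<dots> = (\<Sum>n\<in>freq w ` (K - R). (cmod (fibre_sum (freq w) K d2 n))\<^sup>2)"
      by (simp add: sum.reindex[OF inj])
    also have "\<dots> \<le> B"
      unfolding B_def using K by (intro sum_mono2) auto
    finally show ?thesis .
  qed
  have res: "(cmod (c k))\<^sup>2 \<le> (1 + m)\<^sup>2 * (A + B)" if k: "k \<in> K \<inter> R" for k
  proof -
    define L where "L = {l\<in>K. freq v l = freq v k} - {k}"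
    have L_sub: "L \<subseteq> {l. resonant v l}" unfolding L_def using freq_fibre_subset[of v k] by blast
    then have card_L: "real (card L) \<le> m" unfolding m_def by (simp add: card_mono finite_resonant)
    have "cmod (d1 l) \<le> sqrt (A + B)" if "l \<in> L" for l
    proof -
      have "l \<in> K - R" using that k sep[of k l] by (auto simp: L_def R_def)
      then have "(cmod (c l))\<^sup>2 \<le> (\<Sum>k\<in>K - R. (cmod (c k))\<^sup>2)"
        using K by (intro member_le_sum) auto
      then have "(cmod (d1 l))\<^sup>2 \<le> A + B" using nonres nonneg d by simp
      then show ?thesis by (rule real_le_rsqrt)
    qed
    then have "cmod (sum d1 L) \<le> (\<Sum>l\<in>L. sqrt (A + B))" by (rule sum_norm_le)
    also have "\<dots> \<le> m * sqrt (A + B)"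
      using card_L nonneg by (simp add: mult_right_mono)
    finally have rest: "cmod (sum d1 L) \<le> m * sqrt (A + B)" .
    have "(cmod (fibre_sum (freq v) K d1 (freq v k)))\<^sup>2 \<le> A"
      unfolding A_def using k K by (intro member_le_sum) auto
    then have total: "cmod (fibre_sum (freq v) K d1 (freq v k)) \<le> sqrt (A + B)"
      using nonneg by (intro real_le_rsqrt) simp
    have "fibre_sum (freq v) K d1 (freq v k) = d1 k + sum d1 L"
      unfolding fibre_sum_def L_def using k K by (intro sum.remove) auto
    then have "d1 k = fibre_sum (freq v) K d1 (freq v k) - sum d1 L" by simp
    then have "cmod (c k) \<le> cmod (fibre_sum (freq v) K d1 (freq v k)) + cmod (sum d1 L)"
      using norm_triangle_ineq4[of "fibre_sum (freq v) K d1 (freq v k)" "sum d1 L"] d(1)[of k] by simp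
    also have "\<dots> \<le> (1 + m) * sqrt (A + B)" using total rest by (simp add: distrib_right)
    finally have "(cmod (c k))\<^sup>2 \<le> ((1 + m) * sqrt (A + B))\<^sup>2" by (intro power_mono) auto
    then show ?thesis using nonneg by (simp add: power_mult_distrib)
  qed
  have "(\<Sum>k\<in>K \<inter> R. (cmod (c k))\<^sup>2) \<le> real (card (K \<inter> R)) * ((1 + m)\<^sup>2 * (A + B))"
    by (intro sum_bounded_above res)
  also have "\<dots> \<le> real (card R) * ((1 + m)\<^sup>2 * (A + B))"
    using R nonneg by (intro mult_right_mono) (auto intro!: card_mono)
  finally have "(\<Sum>k\<in>K \<inter> R. (cmod (c k))\<^sup>2) \<le> real (card R) * (1 + m)\<^sup>2 * (A + B)" by (simp add: mult.assoc)
  moreover have "(\<Sum>k\<in>K. (cmod (c k))\<^sup>2) = (\<Sum>k\<in>K \<inter> R. (cmod (c k))\<^sup>2) + (\<Sum>k\<in>K - R. (cmod (c k))\<^sup>2)"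
    using K by (metis sum.Int_Diff)
  ultimately have "(\<Sum>k\<in>K. (cmod (c k))\<^sup>2) \<le> real (card R) * (1 + m)\<^sup>2 * (A + B) + (A + B)"
    using nonres nonneg by linarith
  then show ?thesis unfolding A_def[symmetric] B_def[symmetric] m_def[symmetric] R_def[symmetric]
    by (simp add: distrib_right)
qed

section \<open>Passage from finite sums to the observed restrictions\<close>

lemma partial_sum_observability:
  fixes T :: real
  assumes T: "0 < T"
  shows "\<exists>C>0. \<forall>K d. finite K \<longrightarrow> (\<Sum>n\<in>freq v ` K. (cmod (fibre_sum (freq v) K d n))\<^sup>2) \<le>
    C * (LINT t|lebesgue_on {0..T}. (cmod (\<Sum>k\<in>K. d k * cis (of_int (freq v k) * t)))\<^sup>2)"
proof -
  obtain C where C: "0 < C" "\<And>F a. finite F \<Longrightarrow> F \<subseteq> range (freq v) \<Longrightarrow>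
     (\<Sum>n\<in>F. (cmod (a n))\<^sup>2) \<le> C * integral {0..T} (\<lambda>t. (cmod (trig_sum F a t))\<^sup>2)"
    using observable_freq[OF T, of v] unfolding observable_def by blast
  have "(\<Sum>n\<in>freq v ` K. (cmod (fibre_sum (freq v) K d n))\<^sup>2) \<le>
    C * (LINT t|lebesgue_on {0..T}. (cmod (\<Sum>k\<in>K. d k * cis (of_int (freq v k) * t)))\<^sup>2)" if "finite K" for K d
    unfolding trig_sum_fibre_sum[OF that] lebesgue_integral_square_trig_sum
    using that by (intro C(2)) auto
  then show ?thesis using C(1) by blast
qed

lemma kdv_on_line_partial_sum_bound:
  assumes u: "u \<in> L2_on {0..2 * pi}"
  shows "(LINT t|lebesgue_on {a..b}. (cmod (kdv_partial_sum u N (t0 + t) (x0 - of_int v * t)))\<^sup>2) \<le>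
    2 * (LINT t|lebesgue_on {a..b}. (cmod (kdv_partial_sum u N (t0 + t) (x0 - of_int v * t) - kdv_on_line u t0 x0 v t))\<^sup>2) +
    2 * (LINT t|lebesgue_on {a..b}. (cmod (kdv_on_line u t0 x0 v t))\<^sup>2)"
proof -
  let ?M = "lebesgue_on {a..b}"
  define g where "g t = kdv_partial_sum u N (t0 + t) (x0 - of_int v * t)" for t
  define f where "f = kdv_on_line u t0 x0 v"
  have f: "f \<in> L2_on {a..b}" unfolding f_def by (rule kdv_on_line(1)[OF u])
  have cont: "continuous_on {a..b} g"
    unfolding g_def kdv_partial_sum_def by (intro continuous_intros)
  have g_int: "integrable ?M g" "integrable ?M (\<lambda>t. (cmod (g t))\<^sup>2)"
    using cont by (auto intro!: continuous_imp_integrable_real continuous_intros)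
  have f_int: "integrable ?M f" "integrable ?M (\<lambda>t. (cmod (f t))\<^sup>2)"
    using f by (auto simp: L2_on_def intro: L2_on_integrable)
  have "integrable ?M (\<lambda>t. (cmod (g t - f t))\<^sup>2)"
    using g_int f_int by (intro integrable_cmod_square_diff) auto
  from integrable_cmod_square_le(2)[OF this f_int(2) borel_measurable_integrable[OF g_int(1)]]
  show ?thesis by (simp add: g_def f_def)
qed

lemma observability_on_two_lines:
  fixes T t1 x1 t2 x2 :: real and v w :: int
  assumes T: "0 < T"
    and sep: "\<And>k l. resonant w k \<Longrightarrow> resonant w l \<Longrightarrow> freq v k = freq v l \<Longrightarrow> k = l"
  shows "\<exists>C>0. \<forall>u\<in>L2_on {0..2 * pi}.
     (LINT x|lebesgue_on {0..2 * pi}. (cmod (u x))\<^sup>2) \<le> C *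
       ((LINT t|lebesgue_on {0..T}. (cmod (kdv_on_line u t1 x1 v t))\<^sup>2) +
        (LINT t|lebesgue_on {0..T}. (cmod (kdv_on_line u t2 x2 w t))\<^sup>2))"
proof -
  let ?M = "lebesgue_on {0..T}"
  obtain C1 where C1: "0 < C1" "\<And>K d. finite K \<Longrightarrow> (\<Sum>n\<in>freq v ` K. (cmod (fibre_sum (freq v) K d n))\<^sup>2) \<le>
    C1 * (LINT t|?M. (cmod (\<Sum>k\<in>K. d k * cis (of_int (freq v k) * t)))\<^sup>2)"
    using partial_sum_observability[OF T, of v] by blast
  obtain C2 where C2: "0 < C2" "\<And>K d. finite K \<Longrightarrow> (\<Sum>n\<in>freq w ` K. (cmod (fibre_sum (freq w) K d n))\<^sup>2) \<le>
    C2 * (LINT t|?M. (cmod (\<Sum>k\<in>K. d k * cis (of_int (freq w k) * t)))\<^sup>2)"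
    using partial_sum_observability[OF T, of w] by blast
  define C0 where "C0 = 1 + real (card {k. resonant w k}) * (1 + real (card {k. resonant v k}))\<^sup>2"
  define C where "C = C0 * (C1 + C2)"
  have C0: "1 \<le> C0" by (simp add: C0_def)
  have C: "0 < C" using C0 C1 C2 by (simp add: C_def)
  \<comment> \<open>8 pi = 4 pi * 2: the first factor comes from
    \<open>fourier_coeff_bound_imp_L2_bound\<close>, the second from comparing partial sums with the
    restrictions.\<close>
  have "(LINT x|lebesgue_on {0..2 * pi}. (cmod (u x))\<^sup>2) \<le> 8 * pi * C *
       ((LINT t|?M. (cmod (kdv_on_line u t1 x1 v t))\<^sup>2) + (LINT t|?M. (cmod (kdv_on_line u t2 x2 w t))\<^sup>2))"
    if u: "u \<in> L2_on {0..2 * pi}" for u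
  proof -
    define e1 where "e1 N = (LINT t|?M. (cmod (kdv_partial_sum u N (t1 + t) (x1 - of_int v * t) - kdv_on_line u t1 x1 v t))\<^sup>2)" for N
    define e2 where "e2 N = (LINT t|?M. (cmod (kdv_partial_sum u N (t2 + t) (x2 - of_int w * t) - kdv_on_line u t2 x2 w t))\<^sup>2)" for N
    define I1 where "I1 = (LINT t|?M. (cmod (kdv_on_line u t1 x1 v t))\<^sup>2)"
    define I2 where "I2 = (LINT t|?M. (cmod (kdv_on_line u t2 x2 w t))\<^sup>2)"
    have e: "e1 \<longlonglongrightarrow> 0" "e2 \<longlonglongrightarrow> 0"
      unfolding e1_def e2_def by (rule kdv_on_line(2)[OF u])+
    have "(\<Sum>k=-int N..int N. (cmod (fourier_coeff u k))\<^sup>2) \<le> C * ((2 * e1 N + 2 * I1) + (2 * e2 N + 2 * I2))" for N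
    proof -
      define K where "K = {-int N..int N}"
      define d1 where "d1 k = fourier_coeff u k * cis (of_int k ^ 3 * t1 + of_int k * x1)" for k
      define d2 where "d2 k = fourier_coeff u k * cis (of_int k ^ 3 * t2 + of_int k * x2)" for k
      define J1 where "J1 = (LINT t|?M. (cmod (kdv_partial_sum u N (t1 + t) (x1 - of_int v * t)))\<^sup>2)"
      define J2 where "J2 = (LINT t|?M. (cmod (kdv_partial_sum u N (t2 + t) (x2 - of_int w * t)))\<^sup>2)"
      have J: "0 \<le> J1" "0 \<le> J2" "J1 \<le> 2 * e1 N + 2 * I1" "J2 \<le> 2 * e2 N + 2 * I2"
        unfolding J1_def J2_def e1_def e2_def I1_def I2_def
        by (auto intro!: kdv_on_line_partial_sum_bound[OF u])
      have K: "finite K" by (simp add: K_def)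
      have "(\<Sum>n\<in>freq v ` K. (cmod (fibre_sum (freq v) K d1 n))\<^sup>2) \<le> C1 * J1"
        using C1(2)[OF K, of d1] unfolding J1_def kdv_partial_sum_on_line d1_def K_def .
      moreover have "(\<Sum>n\<in>freq w ` K. (cmod (fibre_sum (freq w) K d2 n))\<^sup>2) \<le> C2 * J2"
        using C2(2)[OF K, of d2] unfolding J2_def kdv_partial_sum_on_line d2_def K_def .
      moreover have "C1 * J1 + C2 * J2 \<le> (C1 + C2) * (J1 + J2)"
        using C1(1) C2(1) J(1,2) by (simp add: distrib_left distrib_right)
      ultimately have le: "(\<Sum>n\<in>freq v ` K. (cmod (fibre_sum (freq v) K d1 n))\<^sup>2) +
          (\<Sum>n\<in>freq w ` K. (cmod (fibre_sum (freq w) K d2 n))\<^sup>2) \<le> (C1 + C2) * (J1 + J2)"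
        by linarith
      have "(\<Sum>k\<in>K. (cmod (fourier_coeff u k))\<^sup>2) \<le> C0 * ((\<Sum>n\<in>freq v ` K. (cmod (fibre_sum (freq v) K d1 n))\<^sup>2) +
          (\<Sum>n\<in>freq w ` K. (cmod (fibre_sum (freq w) K d2 n))\<^sup>2))"
        unfolding C0_def
        by (rule sum_square_le_fibre_sums[OF K]) (simp_all add: d1_def d2_def norm_mult sep)
      also have "\<dots> \<le> C0 * ((C1 + C2) * (J1 + J2))"
        using C0 by (intro mult_left_mono le) auto
      also have "\<dots> \<le> C * ((2 * e1 N + 2 * I1) + (2 * e2 N + 2 * I2))"
        unfolding C_def mult.assoc[symmetric] using C J C_def by (intro mult_left_mono add_mono) auto
      finally show ?thesis by (simp add: K_def)
    qed
    moreover have "(\<lambda>N. C * ((2 * e1 N + 2 * I1) + (2 * e2 N + 2 * I2))) \<longlonglongrightarrow> C * ((2 * 0 + 2 * I1) + (2 * 0 + 2 * I2))"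
      by (intro tendsto_intros e)
    ultimately have "(LINT x|lebesgue_on {0..2 * pi}. (cmod (u x))\<^sup>2) \<le> 4 * pi * (C * ((2 * 0 + 2 * I1) + (2 * 0 + 2 * I2)))"
      by (rule fourier_coeff_bound_imp_L2_bound[OF u])
    then show ?thesis by (simp add: I1_def I2_def algebra_simps)
  qed
  then show ?thesis using C by (intro exI[of _ "8 * pi * C"]) auto
qed

theorem theorem5p4:
  fixes T t1 x1 t2 x2 :: real and v1 v2 :: int
  assumes "T > 0" and "v1 \<noteq> v2"
    and "(v2 > 4 * v1 \<and> 4 * v1 > 0) \<or>
         (\<exists>p::nat. prime p \<and> [p = 2] (mod 3) \<and> ord_at p v1 \<noteq> ord_at p v2)"
  shows "\<exists>C>0. \<forall>u0\<in>L2_torus.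
           (LINT x|lebesgue_on {0..2 * pi}. (cmod (u0 x))\<^sup>2)
             \<le> C * (LINT t|lebesgue_on {0..T}.
                     (cmod (kdv_on_line u0 t1 x1 v1 t))\<^sup>2 + (cmod (kdv_on_line u0 t2 x2 v2 t))\<^sup>2)"
proof -
  \<comment> \<open>The line called w in the resonance lemmas is that of \<open>v1\<close> in case
    (1), and in case (2) the one whose speed has the larger order at p.\<close>
  have "(\<forall>k l. resonant v1 k \<longrightarrow> resonant v1 l \<longrightarrow> freq v2 k = freq v2 l \<longrightarrow> k = l) \<or>
        (\<forall>k l. resonant v2 k \<longrightarrow> resonant v2 l \<longrightarrow> freq v1 k = freq v1 l \<longrightarrow> k = l)"
    using assms(3)
  proof (elim disjE exE conjE)
    assume "4 * v1 < v2"
    then show ?thesis using no_shared_resonance_small by blast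
  next
    fix p assume p: "prime p" "[p = 2] (mod 3)" and "ord_at p v1 \<noteq> ord_at p v2"
    then consider "ord_at p v1 < ord_at p v2" | "ord_at p v2 < ord_at p v1" by (meson linorder_neqE)
    then show ?thesis using no_shared_resonance_prime[OF p] by cases blast+
  qed
  then obtain C where C: "C > 0" "\<And>u. u \<in> L2_on {0..2 * pi} \<Longrightarrow>
      (LINT x|lebesgue_on {0..2 * pi}. (cmod (u x))\<^sup>2) \<le> C *
       ((LINT t|lebesgue_on {0..T}. (cmod (kdv_on_line u t1 x1 v1 t))\<^sup>2) +
        (LINT t|lebesgue_on {0..T}. (cmod (kdv_on_line u t2 x2 v2 t))\<^sup>2))"
    using observability_on_two_lines[OF assms(1), of v2 v1 t1 x1 t2 x2]
      observability_on_two_lines[OF assms(1), of v1 v2 t2 x2 t1 x1]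
    by (auto simp: add.commute)
  \<comment> \<open>Splitting the integral rests on both restrictions being square integrable; a
    divergent integral would be 0 by default.\<close>
  have "(LINT t|lebesgue_on {0..T}. (cmod (kdv_on_line u t1 x1 v1 t))\<^sup>2 + (cmod (kdv_on_line u t2 x2 v2 t))\<^sup>2) =
      (LINT t|lebesgue_on {0..T}. (cmod (kdv_on_line u t1 x1 v1 t))\<^sup>2) +
      (LINT t|lebesgue_on {0..T}. (cmod (kdv_on_line u t2 x2 v2 t))\<^sup>2)" if "u \<in> L2_on {0..2 * pi}" for u
    using kdv_on_line(1)[OF that] by (intro Bochner_Integration.integral_add) (simp_all add: L2_on_def)
  with C show ?thesis by (auto simp: L2_torus_def)
qed

end
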